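(* For every integer $n\geq 2$, the language $R_n$ of $n$-rotating words is a regular language over the alphabet $A_n=\{a_{p,q}\mid 1\leq p<q\leq n\}$.
   Context: For $n\geq 2$ let $A_n=\{a_{p,q}\mid 1\leq p<q\leq n\}$. The dual braid monoid (Birman--Ko--Lee monoid) $B_n^{+*}$ is the monoid presented by generators $A_n$ and relations: $a_{p,q}a_{r,s}=a_{r,s}a_{p,q}$ whenever the intervals $[p,q]$ and $[r,s]$ are disjoint or nested (nested means $r<p<q<s$ or $p<r<s<q$), and $a_{p,q}a_{q,r}=a_{q,r}a_{p,r}=a_{p,r}a_{p,q}$ for $1\leq p<q<r\leq n$. Its elements are called braids; $B_{n-1}^{+*}$ is identified with the submonoid of $B_n^{+*}$ generated by $A_{n-1}$. An $A_n$-word is a word on the alphabet $A_n$; $\varepsilon$ is the empty word. The automorphism $\phi_n$ of $B_n^{+*}$ is given by $\phi_n(a_{p,q})=a_{p+1,q+1}$ for $q\leq n-1$ and $\phi_n(a_{p,n})=a_{1,p+1}$; it is applied letterwise to $A_n$-words. A braid $\gamma$ is a right-divisor of $\beta$ (in $B_n^{+*}$) if $\beta=\beta'\gamma$ for some $\beta'\in B_n^{+*}$. For $n\geq 3$, the $B_{n-1}^{+*}$-tail of $\beta\in B_n^{+*}$ is the maximal (for right-divisibility) right-divisor of $\beta$ lying in $B_{n-1}^{+*}$ (it exists and is unique). Splitting (known fact): for $n\geq3$ and $\beta\in B_n^{+*}$ nontrivial there is a unique sequence $(\beta_b,\ldots,\beta_1)$ of braids of $B_{n-1}^{+*}$ with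 $\beta_b\neq 1$, $\beta=\phi_n^{b-1}(\beta_b)\cdots\phi_n(\beta_2)\,\beta_1$, and such that for each $k$ with $1\le k<b$ the $B_{n-1}^{+*}$-tail of $\phi_n^{b-k}(\beta_b)\cdots\phi_n(\beta_{k+1})$ is trivial. It is called the $\phi_n$-splitting of $\beta$. Rotating normal form: for $\beta\in B_2^{+*}$, $r_2(\beta)$ is the unique word $a_{1,2}^k$ representing $\beta$. For $n\geq3$ and $\beta\in B_n^{+*}$ nontrivial with $\phi_n$-splitting $(\beta_b,\ldots,\beta_1)$, $r_n(\beta)=\phi_n^{b-1}(r_{n-1}(\beta_b))\cdots\phi_n(r_{n-1}(\beta_2))\cdot r_{n-1}(\beta_1)$; and $r_n(1)=\varepsilon$. An $A_n$-word is $n$-rotating if it equals $r_n(\beta)$ for some $\beta\in B_n^{+*}$; $R_n$ is the set of all $n$-rotating words. A language is regular if it is recognized by a finite state automaton. *)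

theory Defs
  imports "HOL-Algebra.Group"
begin

section \<open>The dual braid monoid\<close>

text \<open>The letter \<open>a\<^bsub>p,q\<^esub>\<close> is encoded as the pair \<open>(p, q)\<close>.\<close>

type_synonym letter = "nat \<times> nat"
type_synonym word = "letter list"

definition gens :: "nat \<Rightarrow> letter set" where
  "gens n = {(p, q). 1 \<le> p \<and> p < q \<and> q \<le> n}"

inductive dual_rel :: "nat \<Rightarrow> word \<Rightarrow> word \<Rightarrow> bool" for n :: nat where
  comm: "(p, q) \<in> gens n \<Longrightarrow> (r, s) \<in> gens n \<Longrightarrow>
      q < r \<or> s < p \<or> (r < p \<and> q < s) \<or> (p < r \<and> s < q) \<Longrightarrow>
      dual_rel n [(p, q), (r, s)] [(r, s), (p, q)]"
| tri1: "1 \<le> p \<Longrightarrow> p < q \<Longrightarrow> q < r \<Longrightarrow> r \<le> n \<Longrightarrow>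
      dual_rel n [(p, q), (q, r)] [(q, r), (p, r)]"
| tri2: "1 \<le> p \<Longrightarrow> p < q \<Longrightarrow> q < r \<Longrightarrow> r \<le> n \<Longrightarrow>
      dual_rel n [(q, r), (p, r)] [(p, r), (p, q)]"

text \<open>The monoid congruence on words over \<^term>\<open>gens n\<close> generated by \<^term>\<open>dual_rel n\<close>.\<close>

inductive dual_cong :: "nat \<Rightarrow> word \<Rightarrow> word \<Rightarrow> bool" for n :: nat where
  base: "dual_rel n u v \<Longrightarrow> dual_cong n u v"
| refl: "w \<in> lists (gens n) \<Longrightarrow> dual_cong n w w"
| sym: "dual_cong n u v \<Longrightarrow> dual_cong n v u"
| trans: "dual_cong n u v \<Longrightarrow> dual_cong n v w \<Longrightarrow> dual_cong n u w"
| append: "dual_cong n u v \<Longrightarrow> dual_cong n u' v' \<Longrightarrow> dual_cong n (u @ u') (v @ v')"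

text \<open>Braids are congruence classes of words.\<close>

type_synonym braid = "word set"

definition braid_of :: "nat \<Rightarrow> word \<Rightarrow> braid" where
  "braid_of n w = {v. dual_cong n w v}"

definition dual_braid_monoid :: "nat \<Rightarrow> braid monoid" where
  "dual_braid_monoid n =
     \<lparr> carrier = braid_of n ` lists (gens n),
       mult = (\<lambda>\<beta> \<gamma>. \<Union>u\<in>\<beta>. \<Union>v\<in>\<gamma>. braid_of n (u @ v)),
       one = braid_of n [] \<rparr>"

definition rot :: "nat \<Rightarrow> letter \<Rightarrow> letter" where
  "rot n = (\<lambda>(p, q). if q < n then (p + 1, q + 1) else (1, p + 1))"

definition rot_braid :: "nat \<Rightarrow> braid \<Rightarrow> braid" where
  "rot_braid n \<beta> = (\<Union>w\<in>\<beta>. braid_of n (map (rot n) w))"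

lemma dual_rel_lists: "dual_rel n u v \<Longrightarrow> u \<in> lists (gens n) \<and> v \<in> lists (gens n)"
  by (induction rule: dual_rel.induct) (auto simp: gens_def)

lemma dual_cong_lists: "dual_cong n u v \<Longrightarrow> u \<in> lists (gens n) \<and> v \<in> lists (gens n)"
  by (induction rule: dual_cong.induct) (auto dest: dual_rel_lists)

lemma braid_of_eq_iff:
  assumes "u \<in> lists (gens n)"
  shows "braid_of n u = braid_of n v \<longleftrightarrow> dual_cong n u v"
proof
  assume "braid_of n u = braid_of n v"
  moreover have "u \<in> braid_of n u" using assms by (simp add: braid_of_def dual_cong.refl)
  ultimately show "dual_cong n u v" by (auto simp: braid_of_def intro: dual_cong.sym)
next
  assume "dual_cong n u v"
  then show "braid_of n u = braid_of n v"
    by (auto simp: braid_of_def intro: dual_cong.sym dual_cong.trans)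
qed

lemma braid_of_eqI: "dual_cong n u v \<Longrightarrow> braid_of n u = braid_of n v"
  using braid_of_eq_iff dual_cong_lists by blast

lemma mult_braid_of:
  assumes "u \<in> lists (gens n)" "v \<in> lists (gens n)"
  shows "braid_of n u \<otimes>\<^bsub>dual_braid_monoid n\<^esub> braid_of n v = braid_of n (u @ v)"
proof -
  have eq: "braid_of n (u' @ v') = braid_of n (u @ v)" if "u' \<in> braid_of n u" "v' \<in> braid_of n v" for u' v'
  proof -
    have "dual_cong n u u'" "dual_cong n v v'" using that by (simp_all add: braid_of_def)
    then show ?thesis by (rule braid_of_eqI[OF dual_cong.append, symmetric])
  qed
  have "u \<in> braid_of n u" "v \<in> braid_of n v"
    using assms[THEN dual_cong.refl] by (simp_all add: braid_of_def)
  then have "(\<Union>u'\<in>braid_of n u. \<Union>v'\<in>braid_of n v. braid_of n (u' @ v')) = braid_of n (u @ v)"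
    using eq by blast
  then show ?thesis by (simp add: dual_braid_monoid_def)
qed

lemma monoid_dual_braid_monoid: "monoid (dual_braid_monoid n)"
proof -
  have c: "carrier (dual_braid_monoid n) = braid_of n ` lists (gens n)"
    and o: "\<one>\<^bsub>dual_braid_monoid n\<^esub> = braid_of n []"
    by (simp_all add: dual_braid_monoid_def)
  have e: "[] \<in> lists (gens n)" by simp
  show ?thesis
  proof (rule monoidI, unfold c o)
    show "braid_of n [] \<in> braid_of n ` lists (gens n)" using e by blast
  qed (auto simp: mult_braid_of[unfolded in_lists_conv_set] ball_Un intro!: imageI)
qed

lemma rot_gens: "x \<in> gens n \<Longrightarrow> rot n x \<in> gens n"
  by (auto simp: gens_def rot_def split: if_splits)

lemma map_rot_lists: "w \<in> lists (gens n) \<Longrightarrow> map (rot n) w \<in> lists (gens n)"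
  by (induction w) (auto intro: rot_gens)

lemma dual_cong_rot:
  assumes "dual_cong n u v"
  shows "dual_cong n (map (rot n) u) (map (rot n) v)"
  using assms
proof (induction rule: dual_cong.induct)
  case (base u v)
  then show ?case
  proof (cases rule: dual_rel.cases)
    case (comm p q r s)
    have "dual_rel n [rot n (p, q), rot n (r, s)] [rot n (r, s), rot n (p, q)]"
      unfolding rot_def using comm
      by (auto simp: gens_def intro!: dual_rel.comm)
    then show ?thesis using comm by (simp add: dual_cong.base)
  next
    case (tri1 p q r)
    show ?thesis
    proof (cases "r < n")
      case True
      then show ?thesis using tri1 by (auto simp: rot_def intro!: dual_cong.base dual_rel.tri1)
    next
      case False
      then show ?thesis using tri1 by (auto simp: rot_def intro!: dual_cong.base dual_rel.tri2)
    qed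
  next
    case (tri2 p q r)
    show ?thesis
    proof (cases "r < n")
      case True
      then show ?thesis using tri2 by (auto simp: rot_def intro!: dual_cong.base dual_rel.tri2)
    next
      case False
      have "dual_cong n [(1, p+1), (p+1, q+1)] [(p+1, q+1), (1, q+1)]"
        "dual_cong n [(p+1, q+1), (1, q+1)] [(1, q+1), (1, p+1)]"
        using tri2 by (auto intro!: dual_cong.base dual_rel.tri1 dual_rel.tri2)
      then show ?thesis using tri2 False
        by (auto simp: rot_def intro: dual_cong.trans dual_cong.sym)
    qed
  qed
next
  case (refl w)
  then show ?case by (intro dual_cong.refl map_rot_lists)
next
  case (append u v u' v')
  then show ?case by (simp add: dual_cong.append)
next
  case (sym u v)
  then show ?case using dual_cong.sym by blast
next
  case (trans u v w)
  then show ?case using dual_cong.trans by blast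
qed

lemma rot_braid_of:
  assumes "w \<in> lists (gens n)"
  shows "rot_braid n (braid_of n w) = braid_of n (map (rot n) w)"
proof -
  have "braid_of n (map (rot n) w') = braid_of n (map (rot n) w)" if "w' \<in> braid_of n w" for w'
  proof -
    have "dual_cong n w w'" using that by (simp add: braid_of_def)
    then show ?thesis by (rule braid_of_eqI[OF dual_cong_rot, symmetric])
  qed
  moreover have "w \<in> braid_of n w"
    using dual_cong.refl[OF assms] by (simp add: braid_of_def)
  ultimately show ?thesis unfolding rot_braid_def by blast
qed

lemma rot_braid_hom: "rot_braid n \<in> hom (dual_braid_monoid n) (dual_braid_monoid n)"
proof (rule homI)
  have c: "carrier (dual_braid_monoid n) = braid_of n ` lists (gens n)"
    by (simp add: dual_braid_monoid_def)
  show "rot_braid n x \<in> carrier (dual_braid_monoid n)" if "x \<in> carrier (dual_braid_monoid n)" for x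
    using that map_rot_lists rot_braid_of unfolding c by fast
  show "rot_braid n (x \<otimes>\<^bsub>dual_braid_monoid n\<^esub> y)
      = rot_braid n x \<otimes>\<^bsub>dual_braid_monoid n\<^esub> rot_braid n y"
    if xy: "x \<in> carrier (dual_braid_monoid n)" "y \<in> carrier (dual_braid_monoid n)" for x y
  proof -
    obtain u v where uv: "u \<in> lists (gens n)" "v \<in> lists (gens n)"
      and xy: "x = braid_of n u" "y = braid_of n v"
      using xy unfolding c by blast
    have "u @ v \<in> lists (gens n)" using uv by simp
    then show ?thesis
      unfolding xy mult_braid_of[OF uv] using uv[THEN map_rot_lists]
      by (simp only: rot_braid_of uv mult_braid_of map_append)
  qed
qed

text \<open>
  Every word congruent to a word over \<^term>\<open>gens m\<close> is itself a word over \<^term>\<open>gens m\<close>, and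
  the congruences for \<open>m \<le> n\<close> agree on such words. So the class of such a word is the same set
  for \<open>m\<close> and for \<open>n\<close>, and the usual identification of the monoid on \<^term>\<open>gens m\<close> with the
  submonoid generated by \<^term>\<open>gens m\<close> is an actual inclusion of carriers.
\<close>

lemma dual_cong_restrict:
  assumes "dual_cong n u v" "m \<le> n"
  shows "(u \<in> lists (gens m) \<longleftrightarrow> v \<in> lists (gens m)) \<and>
         (u \<in> lists (gens m) \<longrightarrow> dual_cong m u v)"
  using assms(1)
proof (induction rule: dual_cong.induct)
  case (base u v)
  then show ?case
    by (cases rule: dual_rel.cases)
      (auto simp: gens_def intro!: dual_cong.base dual_rel.intros)
next
  case (append u v u' v')
  then show ?case by (auto intro: dual_cong.append)
next
  case (refl w)
  show ?case using dual_cong.refl by blast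
next
  case (sym u v)
  then show ?case using dual_cong.sym by blast
next
  case (trans u v w)
  then show ?case using dual_cong.trans by blast
qed

lemma dual_cong_mono:
  assumes "dual_cong m u v" "m \<le> n"
  shows "dual_cong n u v"
  using assms(1)
proof (induction rule: dual_cong.induct)
  case (base u v)
  then show ?case using assms(2)
    by (cases rule: dual_rel.cases)
      (auto simp: gens_def intro!: dual_cong.base dual_rel.intros)
next
  case (refl w)
  then show ?case using assms(2) by (intro dual_cong.refl) (auto simp: gens_def)
next
  case (append u v u' v')
  then show ?case by (intro dual_cong.append)
next
  case (sym u v)
  then show ?case using dual_cong.sym by blast
next
  case (trans u v w)
  then show ?case using dual_cong.trans by blast
qed

lemma braid_of_stable:
  assumes "w \<in> lists (gens m)" "m \<le> n"
  shows "braid_of n w = braid_of m w"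
  using assms dual_cong_restrict dual_cong_mono unfolding braid_of_def by blast

lemma carrier_dual_braid_monoid_mono:
  assumes "m \<le> n"
  shows "carrier (dual_braid_monoid m) = braid_of n ` lists (gens m)"
    and "carrier (dual_braid_monoid m) \<subseteq> carrier (dual_braid_monoid n)"
proof -
  show *: "carrier (dual_braid_monoid m) = braid_of n ` lists (gens m)"
    using braid_of_stable[OF _ assms] by (simp add: dual_braid_monoid_def)
  have "gens m \<subseteq> gens n" using assms by (auto simp: gens_def)
  then show "carrier (dual_braid_monoid m) \<subseteq> carrier (dual_braid_monoid n)"
    unfolding * by (auto simp: dual_braid_monoid_def)
qed

lemma mult_dual_braid_monoid_mono:
  assumes "m \<le> n" "\<beta> \<in> carrier (dual_braid_monoid m)" "\<gamma> \<in> carrier (dual_braid_monoid m)"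
  shows "\<beta> \<otimes>\<^bsub>dual_braid_monoid m\<^esub> \<gamma> = \<beta> \<otimes>\<^bsub>dual_braid_monoid n\<^esub> \<gamma>"
proof -
  obtain u v where uv: "u \<in> lists (gens m)" "v \<in> lists (gens m)"
    and b: "\<beta> = braid_of m u" "\<gamma> = braid_of m v"
    using assms by (auto simp: dual_braid_monoid_def)
  have "gens m \<subseteq> gens n" using assms(1) by (auto simp: gens_def)
  then have "u \<in> lists (gens n)" "v \<in> lists (gens n)" using uv by auto
  then have "\<beta> \<otimes>\<^bsub>dual_braid_monoid n\<^esub> \<gamma> = braid_of n (u @ v)"
    unfolding b using uv assms(1) by (simp only: braid_of_stable[symmetric] mult_braid_of)
  also have "\<dots> = braid_of m (u @ v)" using uv assms(1) by (intro braid_of_stable) auto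
  finally show ?thesis using uv b mult_braid_of by simp
qed

section \<open>Splitting and the rotating normal form\<close>

definition right_divides :: "nat \<Rightarrow> braid \<Rightarrow> braid \<Rightarrow> bool" where
  "right_divides n \<gamma> \<beta> \<longleftrightarrow>
     (\<exists>\<beta>'\<in>carrier (dual_braid_monoid n). \<beta> = \<beta>' \<otimes>\<^bsub>dual_braid_monoid n\<^esub> \<gamma>)"

text \<open>\<open>\<tau>\<close> is the tail of the \<open>n\<close>-strand braid \<open>\<beta>\<close> in the monoid on \<open>n - 1\<close> strands.\<close>

definition is_tail :: "nat \<Rightarrow> braid \<Rightarrow> braid \<Rightarrow> bool" where
  "is_tail n \<beta> \<tau> \<longleftrightarrow>
     \<tau> \<in> carrier (dual_braid_monoid (n - 1)) \<and> right_divides n \<tau> \<beta> \<and>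
     (\<forall>\<gamma>\<in>carrier (dual_braid_monoid (n - 1)).
        right_divides n \<gamma> \<beta> \<longrightarrow> right_divides n \<tau> \<gamma> \<longrightarrow> \<gamma> = \<tau>)"

text \<open>
  Sequences \<open>(\<beta>\<^sub>b, \<dots>, \<beta>\<^sub>1)\<close> are represented by lists \<open>[\<beta>\<^sub>1, \<dots>, \<beta>\<^sub>b]\<close>, with \<open>\<beta>\<^sub>1\<close> at the head.
  With \<open>\<phi>\<close> for \<^term>\<open>rot_braid n\<close>, \<open>rot_prod n m [\<gamma>\<^sub>1, \<dots>, \<gamma>\<^sub>l]\<close> is the product
  \<open>\<phi>\<^bsup>m+l-1\<^esup>(\<gamma>\<^sub>l) \<dots> \<phi>\<^bsup>m+1\<^esup>(\<gamma>\<^sub>2) \<phi>\<^bsup>m\<^esup>(\<gamma>\<^sub>1)\<close>; \<open>rot_concat\<close> is its analogue for words.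
\<close>

primrec rot_prod :: "nat \<Rightarrow> nat \<Rightarrow> braid list \<Rightarrow> braid" where
  "rot_prod n m [] = \<one>\<^bsub>dual_braid_monoid n\<^esub>"
| "rot_prod n m (\<gamma> # \<gamma>s) =
     rot_prod n (Suc m) \<gamma>s \<otimes>\<^bsub>dual_braid_monoid n\<^esub> (rot_braid n ^^ m) \<gamma>"

primrec rot_concat :: "nat \<Rightarrow> nat \<Rightarrow> word list \<Rightarrow> word" where
  "rot_concat n m [] = []"
| "rot_concat n m (w # ws) = rot_concat n (Suc m) ws @ map (rot n ^^ m) w"

text \<open>
  For \<open>\<beta>s = [\<beta>\<^sub>1, \<dots>, \<beta>\<^sub>b]\<close>, \<open>rot_prod n 1 (drop k \<beta>s)\<close> is
  \<open>\<phi>\<^bsup>b-k\<^esup>(\<beta>\<^sub>b) \<dots> \<phi>(\<beta>\<^bsub>k+1\<^esub>)\<close>.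
\<close>

definition is_splitting :: "nat \<Rightarrow> braid \<Rightarrow> braid list \<Rightarrow> bool" where
  "is_splitting n \<beta> \<beta>s \<longleftrightarrow>
     \<beta>s \<noteq> [] \<and> set \<beta>s \<subseteq> carrier (dual_braid_monoid (n - 1)) \<and>
     last \<beta>s \<noteq> \<one>\<^bsub>dual_braid_monoid (n - 1)\<^esub> \<and>
     \<beta> = rot_prod n 0 \<beta>s \<and>
     (\<forall>k. 1 \<le> k \<and> k < length \<beta>s \<longrightarrow>
        is_tail n (rot_prod n 1 (drop k \<beta>s)) \<one>\<^bsub>dual_braid_monoid n\<^esub>)"

definition splitting :: "nat \<Rightarrow> braid \<Rightarrow> braid list" where
  "splitting n \<beta> = (THE \<beta>s. is_splitting n \<beta> \<beta>s)"

text \<open>Only \<open>n \<ge> 2\<close> is meaningful; the values for \<open>n < 2\<close> are irrelevant.\<close>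

fun rotating_nf :: "nat \<Rightarrow> braid \<Rightarrow> word" where
  "rotating_nf n \<beta> =
     (if n \<le> 2 then (THE w. w \<in> \<beta> \<and> (\<exists>k. w = replicate k (1, 2)))
      else if \<beta> = \<one>\<^bsub>dual_braid_monoid n\<^esub> then []
      else rot_concat n 0 (map (rotating_nf (n - 1)) (splitting n \<beta>)))"

declare rotating_nf.simps [simp del]

definition rotating_words :: "nat \<Rightarrow> word set" where
  "rotating_words n = rotating_nf n ` carrier (dual_braid_monoid n)"

section \<open>Regular languages\<close>

text \<open>
  Recognition by a deterministic finite automaton with state set \<open>Q\<close>, initial state \<open>q\<^sub>0\<close>,
  accepting states \<open>F\<close> and transition function \<open>\<delta>\<close>. Taking the states in \<^typ>\<open>nat\<close> loses no
  generality, since only their finite number matters.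
\<close>

definition regular_language :: "'a set \<Rightarrow> 'a list set \<Rightarrow> bool" where
  "regular_language \<Sigma> L \<longleftrightarrow>
     (\<exists>(Q :: nat set) q\<^sub>0 F \<delta>.
        finite Q \<and> q\<^sub>0 \<in> Q \<and> F \<subseteq> Q \<and> (\<forall>q\<in>Q. \<forall>a\<in>\<Sigma>. \<delta> q a \<in> Q) \<and>
        L = {w \<in> lists \<Sigma>. foldl \<delta> q\<^sub>0 w \<in> F})"

end

theory Submission
  imports Defs "HOL-Library.Infinite_Set"
begin

text \<open>
  Two facts together make the rotating words regular.

  The first is that finitely much information about a braid \<open>\<beta>\<close> decides which letters divide it on
  the right, and that this information can be updated when \<open>\<beta>\<close> is multiplied by a letter on the
  right. Let \<open>\<delta> = a\<^bsub>1,2\<^esub> a\<^bsub>2,3\<^esub> \<dots> a\<^bsub>n-1,n\<^esub>\<close> be the Garside element and keep the set of common right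
  divisors of \<open>\<beta>\<close> and \<open>\<delta>\<close>. If \<open>s\<close> divides both \<open>\<beta>a\<close> and \<open>\<delta>\<close>, let \<open>qa\<close> be the least common left
  multiple of \<open>s\<close> and \<open>a\<close>. Then \<open>q\<close> divides \<open>\<beta>\<close>; it also divides \<open>\<delta>\<close>, because \<open>qa\<close> does and \<open>\<delta>a = a'\<delta>\<close>
  for a letter \<open>a'\<close>. So the set for \<open>\<beta>a\<close> is computed from the set for \<open>\<beta>\<close>
  (\<open>simple_tails_snoc\<close>).

  This needs right cancellation and least common left multiples in the monoid, which come from
  Garside's inductive argument (\<open>letters_lcm\<close>, \<open>words_lcm\<close>). Its input is a coherence condition on
  triples of letters. Three letters have at most six endpoints and the relations only mention the
  order of the endpoints, so the condition is a finite check on six points (\<open>cube_holds\<close>).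
  Common multiples also make splittings unique (\<open>word_splitting_unique\<close>). They exist because at most
  two inverse rotations bring any letter into the smaller alphabet (\<open>word_splitting_exists\<close>). This
  gives a description of the rotating words by concatenation (\<open>rotating_words_eq\<close>).

  The second fact is that this description can be tested from left to right. A rotating word is a
  concatenation of blocks, each a rotated word of the previous normal form, and at the boundary in
  front of a block whose alphabet is \<open>\<phi>\<^sup>m(A\<^bsub>n-1\<^esub>)\<close> the only requirement is that the prefix read so
  far is nonempty and not right divisible by a letter of \<open>\<phi>\<^sup>m(A\<^bsub>n-1\<^esub>)\<close>. Since \<open>\<phi>\<^sup>n\<close> is the identity, only \<open>m\<close>
  modulo \<open>n\<close> matters. Hence it suffices to remember the common right divisors of the prefix and \<open>\<delta>\<close>,
  together with the set of all pairs formed by a possible rotation \<open>m\<close> and the state that an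
  automaton for the smaller language reaches on the current block. The theorem follows by
  induction on \<open>n\<close> (\<open>regular_rotating_words_step\<close>).
\<close>

section \<open>Words and the congruence\<close>

declare dual_cong.trans [trans]

lemma dual_cong_length: "dual_cong n u v \<Longrightarrow> length u = length v"
  by (induction rule: dual_cong.induct) (auto elim: dual_rel.cases)

lemma dual_cong_Nil: "dual_cong n [] v \<Longrightarrow> v = []" "dual_cong n v [] \<Longrightarrow> v = []"
  using dual_cong_length by fastforce+

lemma dual_cong_appendL: "dual_cong n u v \<Longrightarrow> x \<in> lists (gens n) \<Longrightarrow> dual_cong n (x @ u) (x @ v)"
  by (intro dual_cong.append dual_cong.refl)

lemma dual_cong_appendR: "dual_cong n u v \<Longrightarrow> x \<in> lists (gens n) \<Longrightarrow> dual_cong n (u @ x) (v @ x)"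
  by (intro dual_cong.append dual_cong.refl)

lemma dual_cong_triangle:
  assumes "1 \<le> x" "x < y" "y < z" "z \<le> n"
  shows "dual_cong n [(x, y), (y, z)] [(y, z), (x, z)]"
    "dual_cong n [(y, z), (x, z)] [(x, z), (x, y)]"
    "dual_cong n [(x, y), (y, z)] [(x, z), (x, y)]"
  using assms by (blast intro: dual_cong.base dual_rel.tri1 dual_rel.tri2 dual_cong.trans)+

text \<open>
  Garside's argument runs along a chain of single applications of relations, so the inductively
  defined congruence is first replaced by the reflexive transitive closure of such applications.
\<close>

definition rel_step :: "nat \<Rightarrow> word \<Rightarrow> word \<Rightarrow> bool" where
  "rel_step n u v \<longleftrightarrow> (\<exists>x l r y. u = x @ l @ y \<and> v = x @ r @ y \<and>
     x \<in> lists (gens n) \<and> y \<in> lists (gens n) \<and> (dual_rel n l r \<or> dual_rel n r l))"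

lemma rel_step_dual_cong: "rel_step n u v \<Longrightarrow> dual_cong n u v"
  unfolding rel_step_def
  by (blast intro: dual_cong_appendL dual_cong_appendR dual_cong.base dual_cong.sym)

lemma rel_step_context:
  assumes "rel_step n u v" "x \<in> lists (gens n)" "y \<in> lists (gens n)"
  shows "rel_step n (x @ u @ y) (x @ v @ y)"
proof -
  obtain x' l r y' where *: "u = x' @ l @ y'" "v = x' @ r @ y'"
     "x' \<in> lists (gens n)" "y' \<in> lists (gens n)" "dual_rel n l r \<or> dual_rel n r l"
    using assms(1) unfolding rel_step_def by blast
  then show ?thesis unfolding rel_step_def
    using assms(2,3)
    by (intro exI[of _ "x @ x'"] exI[of _ l] exI[of _ r] exI[of _ "y' @ y"]) auto
qed

lemma rel_steps_context:
  assumes "(rel_step n)\<^sup>*\<^sup>* u v" "x \<in> lists (gens n)" "y \<in> lists (gens n)"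
  shows "(rel_step n)\<^sup>*\<^sup>* (x @ u @ y) (x @ v @ y)"
  using assms(1)
proof (induction rule: rtranclp_induct)
  case (step v w)
  then show ?case using rel_step_context[OF _ assms(2,3)] by (meson rtranclp.rtrancl_into_rtrancl)
qed simp

lemma dual_cong_rel_steps: "dual_cong n u v \<Longrightarrow> (rel_step n)\<^sup>*\<^sup>* u v"
proof (induction rule: dual_cong.induct)
  case (base u v)
  have "rel_step n u v" unfolding rel_step_def
    using base by (intro exI[of _ "[]"] exI[of _ u] exI[of _ v]) simp
  then show ?case by simp
next
  case (sym u v)
  have "symp (rel_step n)" by (rule sympI) (unfold rel_step_def, blast)
  then show ?case using sym.IH by (meson symp_rtranclp sympD)
next
  case (append u v u' v')
  have l: "u' \<in> lists (gens n)" "v \<in> lists (gens n)"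
    using append.hyps dual_cong_lists by blast+
  have "(rel_step n)\<^sup>*\<^sup>* (u @ u') (v @ u')"
    using rel_steps_context[OF append.IH(1), of "[]" u'] l by simp
  moreover have "(rel_step n)\<^sup>*\<^sup>* (v @ u') (v @ v')"
    using rel_steps_context[OF append.IH(2), of v "[]"] l by simp
  ultimately show ?case by simp
qed auto

section \<open>Least common left multiples of two letters\<close>

text \<open>
  \<open>cofactor b a\<close> is the word \<open>w\<close> such that \<open>w a\<close> is the least common left multiple of \<open>a\<close> and \<open>b\<close>.
  It is written with its last letter first: multiples are compared from their right ends, and in
  this form the recursion in \<open>word_lcm\<close> is on list constructors. The two cases of length two are those of
  crossing chords, which occur together in no relation and whose least common multiple is the
  Garside element on their four endpoints.
\<close>

definition cofactor :: "letter \<Rightarrow> letter \<Rightarrow> word" where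
  "cofactor b a = (case a of (p, q) \<Rightarrow> case b of (r, s) \<Rightarrow>
     if p = r then (if q = s then [] else if q < s then [(r, s)] else [(s, q)])
     else if q = s then (if p < r then [(r, s)] else [(r, p)])
     else if q = r then [(p, s)]
     else if s = p then [(r, s)]
     else if p < r \<and> r < q \<and> q < s then [(p, s), (r, q)]
     else if r < p \<and> p < s \<and> s < q then [(s, q), (r, p)]
     else [(r, s)])"

lemma cofactor_self [simp]: "cofactor a a = []"
  by (simp add: cofactor_def split: prod.splits)

text \<open>
  Both sides are expressions of the Garside element on \<open>p < r < q < s\<close>, one for each of the two
  crossing chords as last letter.
\<close>

lemma crossing_lcm:
  assumes "1 \<le> p" "p < r" "r < q" "q < s" "s \<le> n"
  shows "dual_cong n [(r, q), (p, s), (p, q)] [(p, r), (q, s), (r, s)]"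
proof -
  note G = gens_def dual_cong.refl
  (* Rewrite in the triangles p < q < s, then p < r < q, then r < q < s. *)
  have "dual_cong n ([(r, q)] @ [(p, s), (p, q)]) ([(r, q)] @ [(p, q), (q, s)])"
    using assms by (intro dual_cong_appendL)
      (auto simp: G intro!: dual_cong.sym[OF dual_cong.trans[OF dual_cong.base[OF dual_rel.tri1]
          dual_cong.base[OF dual_rel.tri2]]])
  also have "dual_cong n ([(r, q), (p, q)] @ [(q, s)]) ([(p, r), (r, q)] @ [(q, s)])"
    using assms by (intro dual_cong_appendR)
      (auto simp: G intro!: dual_cong.sym[OF dual_cong.base[OF dual_rel.tri1]])
  then have "dual_cong n ([(r, q)] @ [(p, q), (q, s)]) ([(p, r)] @ [(r, q), (q, s)])" by simp
  also have "dual_cong n ([(p, r)] @ [(r, q), (q, s)]) ([(p, r)] @ [(q, s), (r, s)])"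
    using assms by (intro dual_cong_appendL)
      (auto simp: G intro!: dual_cong.base[OF dual_rel.tri1])
  finally show ?thesis by simp
qed

text \<open>
  Every defining relation has the form \<open>(b/a) a = (a/b) b\<close> with cofactors of length one.
\<close>

lemma dual_rel_cofactor:
  assumes "dual_rel n l r"
  shows "\<exists>a b x y. l = [x, a] \<and> r = [y, b] \<and> cofactor b a = [x] \<and> cofactor a b = [y]"
  using assms by (cases rule: dual_rel.cases) (auto simp: cofactor_def gens_def)

lemma cofactor_lcm:
  assumes "a \<in> gens n" "b \<in> gens n"
  shows "dual_cong n (rev (cofactor b a) @ [a]) (rev (cofactor a b) @ [b])"
proof -
  obtain p q where a: "a = (p, q)" by fastforce
  obtain r s where b: "b = (r, s)" by fastforce
  note ab = assms[unfolded a b gens_def, simplified]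
  consider "p = r" "q = s" | "p < r \<and> r < q \<and> q < s" | "r < p \<and> p < s \<and> s < q"
    | "p = r" "q < s" | "p = r" "s < q" | "q = s" "p < r" | "q = s" "r < p" | "q = r" | "p = s"
    | "q < r \<or> s < p \<or> (r < p \<and> q < s) \<or> (p < r \<and> s < q)"
    using less_linear[of p r] less_linear[of q s] less_linear[of q r] less_linear[of p s]
    by blast
  then show ?thesis
  proof cases
    case 1
    then show ?thesis using assms by (simp add: a b dual_cong.refl)
  next
    case 2
    then show ?thesis using ab crossing_lcm[of p r q s n] by (auto simp: a b cofactor_def)
  next
    case 3
    then show ?thesis using ab crossing_lcm[of r p s q n] 
      by (auto simp: a b cofactor_def intro: dual_cong.sym)
  next
    case 10
    have "cofactor b a = [b]" "cofactor a b = [a]" using 10 ab by (auto simp: a b cofactor_def)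
    then show ?thesis using assms 10 by (auto simp: a b intro!: dual_cong.base dual_rel.comm)
  next
    case 4
    then show ?thesis using ab dual_cong_triangle(2)[of p q s n] by (simp add: a b cofactor_def dual_cong.sym)
  next
    case 5
    then show ?thesis using ab dual_cong_triangle(2)[of p s q n] by (simp add: a b cofactor_def)
  next
    case 6
    then show ?thesis using ab dual_cong_triangle(1)[of p r s n] by (simp add: a b cofactor_def dual_cong.sym)
  next
    case 7
    then show ?thesis using ab dual_cong_triangle(1)[of r p q n] by (simp add: a b cofactor_def)
  next
    case 8
    then show ?thesis using ab dual_cong_triangle(3)[of p q s n] by (simp add: a b cofactor_def dual_cong.sym)
  next
    case 9
    then show ?thesis using ab dual_cong_triangle(3)[of r p q n] by (simp add: a b cofactor_def)
  qed
qed

lemma cofactor_gens: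
  assumes "a \<in> gens n" "b \<in> gens n"
  shows "rev (cofactor b a) \<in> lists (gens n)"
  using dual_cong_lists[OF cofactor_lcm[OF assms]] by simp

text \<open>
  Word reversing: the result \<open>(p, q)\<close> satisfies \<open>p u = q v\<close> (all words written backwards). The
  letters \<open>a\<close> and \<open>b\<close> at the right ends are replaced by their least common multiple, and what is left is
  treated in the same way. Reversing need not terminate for an arbitrary complement, hence the
  bound on the recursion depth.
\<close>

fun word_lcm :: "nat \<Rightarrow> word \<Rightarrow> word \<Rightarrow> (word \<times> word) option" where
  "word_lcm k [] v = Some (v, [])"
| "word_lcm k (a # u) [] = Some ([], a # u)"
| "word_lcm 0 (a # u) (b # v) = None"
| "word_lcm (Suc k) (a # u) (b # v) =
    (case word_lcm k u (cofactor b a) of None \<Rightarrow> None | Some (p, q) \<Rightarrow>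
      (case word_lcm k (cofactor a b @ q) v of None \<Rightarrow> None | Some (p', q') \<Rightarrow>
        Some (p @ p', q')))"

lemma word_lcm_sound:
  assumes "word_lcm k u v = Some (p, q)" "rev u \<in> lists (gens n)" "rev v \<in> lists (gens n)"
  shows "dual_cong n (rev p @ rev u) (rev q @ rev v)"
  using assms
proof (induction k u v arbitrary: p q rule: word_lcm.induct)
  case (4 k a u b v)
  obtain p1 q1 p2 where 1: "word_lcm k u (cofactor b a) = Some (p1, q1)"
    and 2: "word_lcm k (cofactor a b @ q1) v = Some (p2, q)" and p: "p = p1 @ p2"
    using 4(3) by (auto split: option.splits)
  have ab: "a \<in> gens n" "b \<in> gens n" and uv: "rev u \<in> lists (gens n)" "rev v \<in> lists (gens n)"
    using 4(4,5) by auto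
  have c1: "dual_cong n (rev p1 @ rev u) (rev q1 @ rev (cofactor b a))"
    using 4(1)[OF 1 uv(1) cofactor_gens[OF ab]] .
  then have q1: "rev q1 \<in> lists (gens n)" using dual_cong_lists by fastforce
  then have "rev (cofactor a b @ q1) \<in> lists (gens n)"
    using cofactor_gens[OF ab(2,1)] by simp
  then have c2: "dual_cong n (rev p2 @ rev (cofactor a b @ q1)) (rev q @ rev v)"
    using 4(2)[OF 1 _ 2] uv(2) by simp
  then have p2: "rev p2 \<in> lists (gens n)" using dual_cong_lists by fastforce
  have "dual_cong n (rev p2 @ (rev p1 @ rev u) @ [a]) (rev p2 @ (rev q1 @ rev (cofactor b a)) @ [a])"
    using p2 ab by (intro dual_cong_appendL dual_cong_appendR c1) auto
  also have "dual_cong n (rev p2 @ rev q1 @ rev (cofactor b a) @ [a])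
      (rev p2 @ rev q1 @ rev (cofactor a b) @ [b])"
    using p2 q1 by (intro dual_cong_appendL cofactor_lcm ab)
  then have "dual_cong n (rev p2 @ (rev q1 @ rev (cofactor b a)) @ [a])
      ((rev p2 @ rev (cofactor a b @ q1)) @ [b])" by simp
  also have "dual_cong n \<dots> ((rev q @ rev v) @ [b])"
    using ab by (intro dual_cong_appendR c2) auto
  finally show ?case by (simp add: p)
qed (simp_all add: dual_cong.refl)

section \<open>The cube condition\<close>

text \<open>
  Any bound is sound here, as an exhausted one makes the condition \<open>cube\<close> false. This one
  is large enough for all triples of letters.
\<close>

definition lcm_depth :: nat where "lcm_depth = Suc (Suc (Suc (Suc (Suc 0))))"

text \<open>
  Computing a common multiple of \<open>a\<close>, \<open>b\<close> and \<open>c\<close> by way of \<open>c\<close>, that is from the least common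
  multiples of \<open>a, c\<close> and of \<open>b, c\<close>, must give a multiple of the least common multiple of \<open>a\<close> and \<open>b\<close>.
  With \<open>p (a/c) = q (b/c)\<close>, this asks for one word \<open>v\<close> with \<open>p (c/a) = v (b/a)\<close> and
  \<open>q (c/b) = v (a/b)\<close>. Equality of words is tested by reversing, which returns two empty
  words only on congruent arguments.
\<close>

definition cube :: "letter \<Rightarrow> letter \<Rightarrow> letter \<Rightarrow> bool" where
  "cube a b c = (case word_lcm lcm_depth (cofactor a c) (cofactor b c) of None \<Rightarrow> False
     | Some (p, q) \<Rightarrow>
       (case word_lcm lcm_depth (cofactor c a @ p) (cofactor b a) of None \<Rightarrow> False
        | Some (z, v) \<Rightarrow> z = [] \<and>
            word_lcm lcm_depth (cofactor c b @ q) (cofactor a b @ v) = Some ([], [])))"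

lemma cofactor_map:
  assumes "strict_mono f"
  shows "cofactor (map_prod f f b) (map_prod f f a) = map (map_prod f f) (cofactor b a)"
  using strict_mono_less[OF assms] strict_mono_eq[OF assms]
  by (cases a; cases b) (simp add: cofactor_def)

text \<open>
  Cofactors depend on the relative order of the endpoints only, so reversing commutes with every
  strictly monotone relabelling.
\<close>

lemma word_lcm_map:
  assumes "strict_mono f"
  shows "word_lcm k (map (map_prod f f) u) (map (map_prod f f) v)
    = map_option (map_prod (map (map_prod f f)) (map (map_prod f f))) (word_lcm k u v)"
proof (induction k u v rule: word_lcm.induct)
  case (4 k a u b v)
  show ?case
  proof (cases "word_lcm k u (cofactor b a)")
    case None
    then show ?thesis using 4(1) by (simp add: cofactor_map[OF assms])
  next
    case (Some pq)
    obtain p q where pq: "pq = (p, q)" by fastforce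
    have "word_lcm k (map (map_prod f f) (cofactor a b @ q)) (map (map_prod f f) v)
      = map_option (map_prod (map (map_prod f f)) (map (map_prod f f)))
         (word_lcm k (cofactor a b @ q) v)"
      using 4(2)[OF Some pq[symmetric]] .
    then show ?thesis using 4(1) Some pq
      by (cases "word_lcm k (cofactor a b @ q) v") (auto simp: cofactor_map[OF assms])
  qed
qed simp_all

lemma cube_map:
  assumes "strict_mono f" "cube a b c"
  shows "cube (map_prod f f a) (map_prod f f b) (map_prod f f c)"
proof -
  let ?f = "map_prod f f"
  obtain p q v where 1: "word_lcm lcm_depth (cofactor a c) (cofactor b c) = Some (p, q)"
    and 2: "word_lcm lcm_depth (cofactor c a @ p) (cofactor b a) = Some ([], v)"
    and 3: "word_lcm lcm_depth (cofactor c b @ q) (cofactor a b @ v) = Some ([], [])"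
    using assms(2) unfolding cube_def by (auto split: option.splits)
  have "word_lcm lcm_depth (map ?f (cofactor a c)) (map ?f (cofactor b c)) = Some (map ?f p, map ?f q)"
    using 1 by (simp add: word_lcm_map[OF assms(1)])
  moreover have "word_lcm lcm_depth (map ?f (cofactor c a) @ map ?f p) (map ?f (cofactor b a))
      = Some ([], map ?f v)"
    using 2 word_lcm_map[OF assms(1), of lcm_depth "cofactor c a @ p" "cofactor b a"] by simp
  moreover have "word_lcm lcm_depth (map ?f (cofactor c b) @ map ?f q) (map ?f (cofactor a b) @ map ?f v)
      = Some ([], [])"
    using 3 word_lcm_map[OF assms(1), of lcm_depth "cofactor c b @ q" "cofactor a b @ v"] by simp
  ultimately show ?thesis
    unfolding cube_def cofactor_map[OF assms(1)] by simp
qed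

definition six_letters :: "letter list" where
  "six_letters = [(0, 1), (0, 2), (0, 3), (0, 4), (0, 5), (1, 2), (1, 3), (1, 4), (1, 5),
     (2, 3), (2, 4), (2, 5), (3, 4), (3, 5), (4, 5)]"

lemma cube_six_letters:
  "list_all (\<lambda>a. list_all (\<lambda>b. list_all (cube a b) six_letters) six_letters) six_letters"
  by code_simp

text \<open>
  The map enumerates \<open>E\<close> in increasing order and continues beyond the maximum of \<open>E\<close>, which makes it
  total and strictly monotone.
\<close>

lemma six_points:
  fixes E :: "nat set"
  assumes "finite E" "card E \<le> 6"
  shows "\<exists>f :: nat \<Rightarrow> nat. strict_mono f \<and> E \<subseteq> f ` {..<6}"
proof -
  (* Adding everything above E makes the set infinite without changing the order of E. *)
  define T where "T = E \<union> {x. \<forall>e\<in>E. e < x}"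
  have "infinite T"
  proof -
    have "{Suc (Max E)..} \<subseteq> T" if "E \<noteq> {}"
      using assms(1) that by (auto simp: T_def Suc_le_eq dest: Max_ge[OF assms(1)])
    moreover have "T = UNIV" if "E = {}" using that by (simp add: T_def)
    ultimately show ?thesis by (metis infinite_UNIV_nat infinite_Ici finite_subset)
  qed
  define f where "f = enumerate T"
  have sm: "strict_mono f" unfolding f_def using \<open>infinite T\<close> by (rule strict_mono_enumerate)
  have "x \<in> f ` {..<6}" if "x \<in> E" for x
  proof -
    have "x \<in> T" using that by (simp add: T_def)
    then obtain i where i: "f i = x" unfolding f_def using enumerate_Ex[OF \<open>infinite T\<close>] by blast
    have "f ` {..i} \<subseteq> E"
    proof
      fix y assume "y \<in> f ` {..i}"
      then have "y \<le> x" "y \<in> T"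
        using i sm enumerate_in_set[OF \<open>infinite T\<close>] by (auto simp: strict_mono_less_eq f_def)
      then show "y \<in> E" using that by (force simp: T_def)
    qed
    then have "card (f ` {..i}) \<le> 6" using assms by (meson card_mono le_trans)
    then have "i < 6" using sm by (simp add: card_image strict_mono_imp_inj_on)
    then show ?thesis using i by blast
  qed
  then show ?thesis using sm by blast
qed

lemma cube_holds:
  assumes "a \<in> gens n" "b \<in> gens n" "c \<in> gens n"
  shows "cube a b c"
proof -
  let ?E = "{fst a, snd a, fst b, snd b, fst c, snd c}"
  have "card ?E \<le> 6"
    using card_length[of "[fst a, snd a, fst b, snd b, fst c, snd c]"] by simp
  then obtain f :: "nat \<Rightarrow> nat" where f: "strict_mono f" "?E \<subseteq> f ` {..<6}"
    using six_points[of ?E] by auto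
  have *: "\<exists>x \<in> set six_letters. y = map_prod f f x"
    if y: "y \<in> gens n" "fst y \<in> ?E" "snd y \<in> ?E" for y
  proof -
    obtain i j where ij: "i < 6" "j < 6" "fst y = f i" "snd y = f j"
      using subsetD[OF f(2) y(2)] subsetD[OF f(2) y(3)] by blast
    then have y_eq: "y = map_prod f f (i, j)" by (simp add: prod_eq_iff)
    then have "i < j" using y(1) strict_mono_less[OF f(1)] by (auto simp: gens_def y_eq)
    then have "(i, j) \<in> set six_letters"
      using ij(1,2) by (auto simp: six_letters_def less_Suc_eq numeral_eq_Suc)
    then show ?thesis using y_eq by blast
  qed
  obtain a' where a: "a' \<in> set six_letters" "a = map_prod f f a'" using *[OF assms(1)] by auto
  obtain b' where b: "b' \<in> set six_letters" "b = map_prod f f b'" using *[OF assms(2)] by auto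
  obtain c' where c: "c' \<in> set six_letters" "c = map_prod f f c'" using *[OF assms(3)] by auto
  have "cube a' b' c'" using cube_six_letters a(1) b(1) c(1) by (simp add: list_all_iff)
  then show ?thesis using cube_map[OF f(1)] by (simp add: a b c)
qed

section \<open>Common left multiples and cancellation\<close>

text \<open>
  The induction hypothesis of Garside's argument.
\<close>

definition lcms_below :: "nat \<Rightarrow> nat \<Rightarrow> bool" where
  "lcms_below n L \<longleftrightarrow> (\<forall>X Y a b. dual_cong n (X @ [a]) (Y @ [b]) \<longrightarrow> length X < L \<longrightarrow>
     (\<exists>Z. dual_cong n X (Z @ rev (cofactor b a)) \<and> dual_cong n Y (Z @ rev (cofactor a b))))"

text \<open>
  What holds for two letters extends to any two words on which reversing terminates: each step
  exchanges a pair of last letters for their cofactors, inside a common multiple that is never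
  longer than the given one.
\<close>

lemma word_lcm_universal:
  assumes "lcms_below n L" "word_lcm k u v = Some (p, q)"
    and "dual_cong n (X @ rev u) (Y @ rev v)" "length (X @ rev u) \<le> L"
  shows "\<exists>Z. dual_cong n X (Z @ rev p) \<and> dual_cong n Y (Z @ rev q)"
  using assms(2-)
proof (induction k u v arbitrary: p q X Y rule: word_lcm.induct)
  case (1 k v)
  then show ?case using dual_cong_lists[OF 1(2)] by (auto intro!: exI[of _ Y] dual_cong.refl)
next
  case (2 k a u)
  then show ?case using dual_cong_lists[OF 2(2)]
    by (auto intro!: exI[of _ X] dual_cong.refl intro: dual_cong.sym)
next
  case (4 k a u b v)
  obtain p1 q1 p2 where 1: "word_lcm k u (cofactor b a) = Some (p1, q1)"
    and 2: "word_lcm k (cofactor a b @ q1) v = Some (p2, q)" and p: "p = p1 @ p2"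
    using 4(3) by (auto split: option.splits)
  have ab: "a \<in> gens n" "b \<in> gens n" using dual_cong_lists[OF 4(4)] by auto
  have "dual_cong n ((X @ rev u) @ [a]) ((Y @ rev v) @ [b])" "length (X @ rev u) < L"
    using 4(4,5) by simp_all
  then obtain Z where Z: "dual_cong n (X @ rev u) (Z @ rev (cofactor b a))"
      "dual_cong n (Y @ rev v) (Z @ rev (cofactor a b))"
    using assms(1) unfolding lcms_below_def by blast
  obtain Z1 where Z1: "dual_cong n X (Z1 @ rev p1)" "dual_cong n Z (Z1 @ rev q1)"
    using 4(1)[OF 1 Z(1)] 4(5) by auto
  have "dual_cong n (Z @ rev (cofactor a b)) ((Z1 @ rev q1) @ rev (cofactor a b))"
    using cofactor_gens[OF ab(2,1)] by (intro dual_cong_appendR Z1)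
  then have c: "dual_cong n (Z1 @ rev (cofactor a b @ q1)) (Y @ rev v)"
    using Z(2) by simp (meson dual_cong.sym dual_cong.trans)
  have "length (Z1 @ rev (cofactor a b @ q1)) \<le> L"
    using dual_cong_length[OF c] dual_cong_length[OF 4(4)] 4(5) by simp
  then obtain Z2 where Z2: "dual_cong n Z1 (Z2 @ rev p2)" "dual_cong n Y (Z2 @ rev q)"
    using 4(2)[OF 1 HOL.refl 2 c] by auto
  have "rev p1 \<in> lists (gens n)" using dual_cong_lists[OF Z1(1)] by simp
  then have "dual_cong n (Z1 @ rev p1) ((Z2 @ rev p2) @ rev p1)"
    by (intro dual_cong_appendR Z2)
  then show ?case using Z1(1) Z2(2) by (simp add: p) (meson dual_cong.trans)
qed simp

text \<open>
  The passage from the pair \<open>a, c\<close> to the pair \<open>a, b\<close> when the last letter \<open>c\<close> is exchanged for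
  \<open>b\<close> by a relation. The two factorisations of the middle word, \<open>Z (a/c)\<close> and \<open>W (b/c)\<close>, have a
  common refinement by the induction hypothesis, and the cube condition rewrites it.
\<close>

lemma cube_lcm:
  assumes "lcms_below n L" "dual_cong n (Z @ rev (cofactor a c)) (W @ rev (cofactor b c))"
    and "length (Z @ rev (cofactor a c)) \<le> L"
    and gens: "a \<in> gens n" "b \<in> gens n" "c \<in> gens n"
  shows "\<exists>V. dual_cong n (Z @ rev (cofactor c a)) (V @ rev (cofactor b a)) \<and>
             dual_cong n (W @ rev (cofactor c b)) (V @ rev (cofactor a b))"
proof -
  obtain p q v where 1: "word_lcm lcm_depth (cofactor a c) (cofactor b c) = Some (p, q)"
    and 2: "word_lcm lcm_depth (cofactor c a @ p) (cofactor b a) = Some ([], v)"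
    and 3: "word_lcm lcm_depth (cofactor c b @ q) (cofactor a b @ v) = Some ([], [])"
    using cube_holds[OF gens] unfolding cube_def by (auto split: option.splits)
  obtain Y where Y: "dual_cong n Z (Y @ rev p)" "dual_cong n W (Y @ rev q)"
    using word_lcm_universal[OF assms(1) 1 assms(2,3)] by blast
  have l: "rev p \<in> lists (gens n)" "rev q \<in> lists (gens n)" "Y \<in> lists (gens n)"
    using dual_cong_lists[OF Y(1)] dual_cong_lists[OF Y(2)] by auto
  note cof = cofactor_gens[OF gens(1,2)] cofactor_gens[OF gens(2,1)]
    cofactor_gens[OF gens(1,3)] cofactor_gens[OF gens(3,1)]
    cofactor_gens[OF gens(2,3)] cofactor_gens[OF gens(3,2)]
  have 2: "dual_cong n (rev (cofactor c a @ p)) (rev v @ rev (cofactor b a))"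
    using word_lcm_sound[OF 2, of n] cof l by simp
  then have v: "rev v \<in> lists (gens n)" using dual_cong_lists by fastforce
  have 3: "dual_cong n (rev (cofactor c b @ q)) (rev (cofactor a b @ v))"
    using word_lcm_sound[OF 3, of n] cof l v by simp
  have "dual_cong n (Z @ rev (cofactor c a)) ((Y @ rev p) @ rev (cofactor c a))"
    using Y cof by (intro dual_cong_appendR)
  also have "dual_cong n ((Y @ rev p) @ rev (cofactor c a)) (Y @ rev v @ rev (cofactor b a))"
    using dual_cong_appendL[OF 2 l(3)] by simp
  finally have V1: "dual_cong n (Z @ rev (cofactor c a)) ((Y @ rev v) @ rev (cofactor b a))"
    by simp
  have "dual_cong n (W @ rev (cofactor c b)) ((Y @ rev q) @ rev (cofactor c b))"
    using Y cof by (intro dual_cong_appendR)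
  also have "dual_cong n ((Y @ rev q) @ rev (cofactor c b)) (Y @ rev v @ rev (cofactor a b))"
    using dual_cong_appendL[OF 3 l(3)] by simp
  finally have "dual_cong n (W @ rev (cofactor c b)) ((Y @ rev v) @ rev (cofactor a b))"
    by simp
  with V1 show ?thesis by blast
qed

text \<open>
  Garside's argument. By induction on the length, follow a chain of relations from \<open>X a\<close> to \<open>Y b\<close>
  and keep the claim true for every word on the way. A relation applied to the left of the last
  letter changes nothing but the first factor. A relation at the right end exchanges the last letter, and this
  is the situation of \<open>cube_lcm\<close>. For \<open>a = b\<close> the cofactors are empty and the statement is
  right cancellation of a letter.
\<close>

lemma letters_lcm:
  assumes "dual_cong n (X @ [a]) (Y @ [b])"
  shows "\<exists>Z. dual_cong n X (Z @ rev (cofactor b a)) \<and> dual_cong n Y (Z @ rev (cofactor a b))"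
  using assms
proof (induction "length X" arbitrary: X Y a b rule: less_induct)
  case less
  have below: "lcms_below n (length X)"
    unfolding lcms_below_def using less.hyps by blast
  have X: "X \<in> lists (gens n)" "a \<in> gens n" using dual_cong_lists[OF less.prems] by auto
  have "(rel_step n)\<^sup>*\<^sup>* (X @ [a]) (Y @ [b])"
    using less.prems by (rule dual_cong_rel_steps)
  then show ?case
  proof (induction "Y @ [b]" arbitrary: Y b rule: rtranclp_induct)
    case base
    then show ?case using X by (auto intro!: exI[of _ X] dual_cong.refl)
  next
    case (step w)
    from step.hyps(2) obtain x l r y where w: "w = x @ l @ y" and Yb: "Y @ [b] = x @ r @ y"
      and xy: "x \<in> lists (gens n)" "y \<in> lists (gens n)" and lr: "dual_rel n l r \<or> dual_rel n r l"
      unfolding rel_step_def by blast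
    obtain c b' l' r' where c: "l = [l', c]" "r = [r', b']"
        "cofactor b' c = [l']" "cofactor c b' = [r']"
      using lr by (elim disjE) (drule dual_rel_cofactor, blast)+
    have lrc: "dual_cong n l r" using lr by (auto intro: dual_cong.base dual_cong.sym)
    show ?case
    proof (cases y rule: rev_cases)
      case Nil
      then have Y: "b' = b" "Y = x @ [r']" using Yb c by auto
      have w': "w = (x @ [l']) @ [c]" using Nil w c by simp
      obtain Z where Z: "dual_cong n X (Z @ rev (cofactor c a))"
          "dual_cong n (x @ [l']) (Z @ rev (cofactor a c))"
        using step.hyps(3)[OF w'] by blast
      have g: "b \<in> gens n" "c \<in> gens n" using dual_cong_lists[OF lrc] c Y by auto
      have "length X = length (x @ [l'])"
      proof -
        have "dual_cong n (X @ [a]) w"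
          using step.hyps(1)
        proof (induction rule: rtranclp_induct)
          case base
          then show ?case using X by (intro dual_cong.refl) simp
        next
          case (step y z)
          then show ?case by (blast intro: dual_cong.trans rel_step_dual_cong)
        qed
        then show ?thesis using dual_cong_length w' by fastforce
      qed
      then have "length (Z @ rev (cofactor a c)) \<le> length X"
        using dual_cong_length[OF Z(2)] by simp
      then obtain V where "dual_cong n (Z @ rev (cofactor c a)) (V @ rev (cofactor b a))"
          "dual_cong n (x @ rev (cofactor c b)) (V @ rev (cofactor a b))"
        using cube_lcm[OF below, of Z a c x b] dual_cong.sym[OF Z(2)] X(2) g c(3) Y(1) by auto
      then show ?thesis using Z(1) Y c by simp (meson dual_cong.trans)
    next
      case (snoc y' b'')
      then have Y: "b'' = b" "Y = x @ r @ y'" using Yb by auto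
      have w': "w = (x @ l @ y') @ [b]" using snoc w Y by simp
      obtain Z where Z: "dual_cong n X (Z @ rev (cofactor b a))"
          "dual_cong n (x @ l @ y') (Z @ rev (cofactor a b))"
        using step.hyps(3)[OF w'] by blast
      have "dual_cong n (x @ r @ y') (x @ l @ y')"
        using xy snoc by (intro dual_cong_appendL dual_cong_appendR dual_cong.sym[OF lrc]) auto
      then show ?thesis using Z Y by simp (meson dual_cong.trans)
    qed
  qed
qed

lemma dual_cong_cancel:
  assumes "dual_cong n (X @ w) (Y @ w)"
  shows "dual_cong n X Y"
  using assms
proof (induction w arbitrary: X Y rule: rev_induct)
  case (snoc a w)
  then have "dual_cong n ((X @ w) @ [a]) ((Y @ w) @ [a])" by simp
  from letters_lcm[OF this] have "dual_cong n (X @ w) (Y @ w)"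
    by simp (meson dual_cong.sym dual_cong.trans)
  then show ?case by (rule snoc.IH)
qed simp

text \<open>
  Two words with some common left multiple have a least one. The words \<open>p\<close> and \<open>q\<close> are again found
  by reversing; the given multiple bounds the lengths, so that no termination argument
  is required. Since cofactors of letters of \<open>gens m\<close> stay in \<open>gens m\<close>, so do \<open>p\<close> and \<open>q\<close>: this is what
  makes the submonoid on fewer strands closed under least common multiples.
\<close>

lemma words_lcm:
  assumes "dual_cong n (X @ u) (Y @ v)"
  shows "\<exists>p q. dual_cong n (p @ u) (q @ v) \<and>
    (\<forall>m. u \<in> lists (gens m) \<longrightarrow> v \<in> lists (gens m) \<longrightarrow>
       p \<in> lists (gens m) \<and> q \<in> lists (gens m)) \<and>
    (\<forall>X Y. dual_cong n (X @ u) (Y @ v) \<longrightarrow>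
       (\<exists>Z. dual_cong n X (Z @ p) \<and> dual_cong n Y (Z @ q)))"
  using assms
proof (induction "length (X @ u)" arbitrary: X Y u v rule: less_induct)
  case less
  have l: "u \<in> lists (gens n)" "v \<in> lists (gens n)" using dual_cong_lists[OF less.prems] by auto
  show ?case
  proof (cases u rule: rev_cases)
    case Nil
    (* If one of the words is empty, the other one is the least common multiple. *)
    have "\<exists>Z. dual_cong n X (Z @ v) \<and> dual_cong n Y (Z @ [])" if "dual_cong n (X @ []) (Y @ v)" for X Y
      using that dual_cong_lists[OF that] by (intro exI[of _ Y]) (simp add: dual_cong.refl)
    then show ?thesis using dual_cong.refl[OF l(2)] unfolding Nil
      by (intro exI[of _ v] exI[of _ "[]"]) simp
  next
    case u: (snoc u' a)
    show ?thesis
    proof (cases v rule: rev_cases)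
      case Nil
      have "\<exists>Z. dual_cong n X (Z @ []) \<and> dual_cong n Y (Z @ u)" if "dual_cong n (X @ u) (Y @ [])" for X Y
        using that dual_cong_lists[OF that]
        by (intro exI[of _ X]) (simp add: dual_cong.refl dual_cong.sym)
      then show ?thesis using dual_cong.refl[OF l(1)] unfolding Nil
        by (intro exI[of _ "[]"] exI[of _ u]) simp
    next
      case v: (snoc v' b)
      define c d where "c = rev (cofactor b a)" and "d = rev (cofactor a b)"
      have ab: "a \<in> gens n" "b \<in> gens n" using l u v by auto
      have cd: "c \<in> lists (gens m)" "d \<in> lists (gens m)"
        if "a \<in> gens m" "b \<in> gens m" for m
        unfolding c_def d_def using cofactor_gens that by blast+
      (* One reversing step: cancel the last letters a and b against their least common multiple. *)
      have split: "\<exists>Z. dual_cong n (X @ u') (Z @ c) \<and> dual_cong n (Y @ v') (Z @ d)"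
        if "dual_cong n (X @ u) (Y @ v)" for X Y
        using that letters_lcm[of n "X @ u'" a "Y @ v'" b] by (simp add: u v c_def d_def)
      obtain Z0 where Z0: "dual_cong n (X @ u') (Z0 @ c)" "dual_cong n (Y @ v') (Z0 @ d)"
        using split[OF less.prems] by blast
      have "length (X @ u') < length (X @ u)" by (simp add: u)
      from less.hyps[OF this Z0(1)] obtain p1 q1 where pq1: "dual_cong n (p1 @ u') (q1 @ c)"
        and lists1: "\<forall>m. u' \<in> lists (gens m) \<longrightarrow> c \<in> lists (gens m) \<longrightarrow>
            p1 \<in> lists (gens m) \<and> q1 \<in> lists (gens m)"
        and univ1: "\<forall>X Y. dual_cong n (X @ u') (Y @ c) \<longrightarrow>
            (\<exists>Z. dual_cong n X (Z @ p1) \<and> dual_cong n Y (Z @ q1))"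
        by (elim exE conjE) (rule that)
      have step: "\<exists>Z. dual_cong n X (Z @ p1) \<and> dual_cong n (Z @ q1 @ d) (Y @ v')"
        if XY: "dual_cong n (X @ u) (Y @ v)" for X Y
      proof -
        obtain Z where Z: "dual_cong n (X @ u') (Z @ c)" "dual_cong n (Y @ v') (Z @ d)"
          using split[OF XY] by blast
        obtain Z1 where Z1: "dual_cong n X (Z1 @ p1)" "dual_cong n Z (Z1 @ q1)"
          using univ1 Z(1) by blast
        have "dual_cong n (Z @ d) ((Z1 @ q1) @ d)" using Z1 cd[OF ab] by (intro dual_cong_appendR)
        then have "dual_cong n (Z1 @ q1 @ d) (Y @ v')"
          using Z(2) by simp (meson dual_cong.sym dual_cong.trans)
        then show ?thesis using Z1 by blast
      qed
      obtain Z1 where Z1: "dual_cong n (Z1 @ q1 @ d) (Y @ v')" using step[OF less.prems] by blast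
      have "length (Z1 @ q1 @ d) < length (X @ u)"
        using dual_cong_length[OF Z1] dual_cong_length[OF less.prems] v by simp
      from less.hyps[OF this Z1] obtain p2 q2 where 2: "dual_cong n (p2 @ q1 @ d) (q2 @ v')"
        and lists2: "\<forall>m. q1 @ d \<in> lists (gens m) \<longrightarrow> v' \<in> lists (gens m) \<longrightarrow>
            p2 \<in> lists (gens m) \<and> q2 \<in> lists (gens m)"
        and univ2: "\<forall>X Y. dual_cong n (X @ q1 @ d) (Y @ v') \<longrightarrow>
            (\<exists>Z. dual_cong n X (Z @ p2) \<and> dual_cong n Y (Z @ q2))"
        by (elim exE conjE) (rule that)
      have l2: "p2 \<in> lists (gens n)" "q1 \<in> lists (gens n)" using dual_cong_lists[OF 2] by auto
      have p1l: "p1 \<in> lists (gens n)" using dual_cong_lists[OF pq1] by auto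
      show ?thesis
      proof (rule exI[of _ "p2 @ p1"], rule exI[of _ q2], intro conjI allI impI)
        have "dual_cong n (p2 @ (p1 @ u') @ [a]) (p2 @ (q1 @ c) @ [a])"
          using l2 ab by (intro dual_cong_appendL dual_cong_appendR pq1) auto
        also have "dual_cong n (p2 @ (q1 @ c) @ [a]) (p2 @ q1 @ d @ [b])"
          using dual_cong_appendL[OF dual_cong_appendL[OF cofactor_lcm[OF ab] l2(2)] l2(1)]
          by (simp add: c_def d_def)
        also have "dual_cong n (p2 @ q1 @ d @ [b]) (q2 @ v' @ [b])"
          using dual_cong_appendR[OF 2, of "[b]"] ab by simp
        finally show "dual_cong n ((p2 @ p1) @ u) (q2 @ v)" by (simp add: u v)
        fix m assume m: "u \<in> lists (gens m)" "v \<in> lists (gens m)"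
        then have ab': "a \<in> gens m" "b \<in> gens m" by (auto simp: u v)
        have uv': "u' \<in> lists (gens m)" "v' \<in> lists (gens m)" using m by (auto simp: u v)
        have pq: "p1 \<in> lists (gens m)" "q1 @ d \<in> lists (gens m)"
          using lists1 uv'(1) cd[OF ab'] by (simp_all del: in_lists_conv_set)
        have pq': "p2 \<in> lists (gens m)" "q2 \<in> lists (gens m)"
          using lists2 pq(2) uv'(2) by blast+
        then show "p2 @ p1 \<in> lists (gens m)" "q2 \<in> lists (gens m)"
          using pq by simp_all
      next
        fix X Y assume "dual_cong n (X @ u) (Y @ v)"
        then obtain Z where Z: "dual_cong n X (Z @ p1)" "dual_cong n (Z @ q1 @ d) (Y @ v')"
          using step by blast
        obtain Z' where Z': "dual_cong n Z (Z' @ p2)" "dual_cong n Y (Z' @ q2)"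
          using univ2 Z(2) by blast
        have "dual_cong n (Z @ p1) ((Z' @ p2) @ p1)" using Z' p1l by (intro dual_cong_appendR)
        then show "\<exists>Z. dual_cong n X (Z @ p2 @ p1) \<and> dual_cong n Y (Z @ q2)"
          using Z(1) Z'(2) by simp (meson dual_cong.trans)
      qed
    qed
  qed
qed

section \<open>Right division and the Garside word\<close>

definition right_div :: "nat \<Rightarrow> word \<Rightarrow> word \<Rightarrow> bool" where
  "right_div n s w \<longleftrightarrow> (\<exists>X. dual_cong n w (X @ s))"

lemma right_div_lists: "right_div n s w \<Longrightarrow> s \<in> lists (gens n)"
  unfolding right_div_def using dual_cong_lists by fastforce

lemma right_div_cong: "right_div n s w \<Longrightarrow> dual_cong n w w' \<Longrightarrow> right_div n s w'"
  unfolding right_div_def using dual_cong.trans[OF dual_cong.sym] by blast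

lemma right_div_trans: 
  assumes "right_div n s t" "right_div n t w" 
  shows "right_div n s w"
proof -
  obtain X Y where *: "dual_cong n t (X @ s)" "dual_cong n w (Y @ t)"
    using assms unfolding right_div_def by blast
  have "dual_cong n (Y @ t) (Y @ X @ s)"
    using * dual_cong_lists[OF *(2)] by (intro dual_cong_appendL) auto
  with *(2) have "dual_cong n w (Y @ X @ s)" by (rule dual_cong.trans)
  then have "dual_cong n w ((Y @ X) @ s)" by simp
  then show ?thesis unfolding right_div_def by blast
qed

lemma right_div_append:
  assumes "right_div n s w" "x \<in> lists (gens n)"
  shows "right_div n (s @ x) (w @ x)"
proof -
  obtain X where "dual_cong n w (X @ s)" using assms(1) unfolding right_div_def by blast
  from dual_cong_appendR[OF this assms(2)] have "dual_cong n (w @ x) (X @ s @ x)" by simp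
  then show ?thesis unfolding right_div_def by blast
qed

lemma right_div_suffix: "X @ s \<in> lists (gens n) \<Longrightarrow> right_div n s (X @ s)"
  unfolding right_div_def by (intro exI[of _ X] dual_cong.refl)

lemma right_div_Nil: "right_div n s [] \<Longrightarrow> s = []"
  unfolding right_div_def using dual_cong_Nil by fastforce

text \<open>
  \<open>chain i j\<close> is the Garside element of the strands \<open>i, \<dots>, j\<close>.
\<close>

definition chain :: "nat \<Rightarrow> nat \<Rightarrow> word" where
  "chain i j = map (\<lambda>k. (k, Suc k)) [i..<j]"

abbreviation delta :: "nat \<Rightarrow> word" where
  "delta n \<equiv> chain 1 n"

lemma chain_lists: "1 \<le> i \<Longrightarrow> j \<le> n \<Longrightarrow> chain i j \<in> lists (gens n)"
  by (auto simp: chain_def gens_def)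

lemma chain_Suc: "i \<le> j \<Longrightarrow> chain i (Suc j) = chain i j @ [(j, Suc j)]"
  by (simp add: chain_def)

lemma chain_Cons: "i < j \<Longrightarrow> chain i j = (i, Suc i) # chain (Suc i) j"
  by (simp add: chain_def upt_conv_Cons)

lemma chain_append: "i \<le> j \<Longrightarrow> j \<le> k \<Longrightarrow> chain i k = chain i j @ chain j k"
  using upt_add_eq_append[of i j "k - j"] by (simp add: chain_def flip: map_append)

lemma dual_cong_commute:
  assumes "(p, q) \<in> gens n" "w \<in> lists (gens n)"
    and "\<And>r s. (r, s) \<in> set w \<Longrightarrow> q < r \<or> s < p \<or> (r < p \<and> q < s) \<or> (p < r \<and> s < q)"
  shows "dual_cong n ((p, q) # w) (w @ [(p, q)])"
  using assms(2,3)
proof (induction w rule: list.induct)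
  case Nil
  then show ?case using assms(1) by (simp add: dual_cong.refl)
next
  case (Cons x w)
  obtain r s where x: "x = (r, s)" by fastforce
  have xw: "(r, s) \<in> gens n" "w \<in> lists (gens n)" using Cons.prems(1) x by auto
  have rs: "q < r \<or> s < p \<or> (r < p \<and> q < s) \<or> (p < r \<and> s < q)"
    using Cons.prems(2)[of r s] x by simp
  have "dual_cong n ([(p, q), (r, s)] @ w) ([(r, s), (p, q)] @ w)"
    using dual_cong.base[OF dual_rel.comm[OF assms(1) xw(1) rs]] xw(2) by (rule dual_cong_appendR)
  also have "[(r, s), (p, q)] @ w = [(r, s)] @ (p, q) # w" by simp
  also have "dual_cong n \<dots> ([(r, s)] @ w @ [(p, q)])"
    using Cons.prems(2) xw by (intro dual_cong_appendL Cons.IH) auto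
  finally show ?case by (simp add: x)
qed

text \<open>
  Move each new letter \<open>a\<^bsub>j,j+1\<^esub>\<close> across \<open>a\<^bsub>i,j\<^esub>\<close>, which turns the latter into \<open>a\<^bsub>i,j+1\<^esub>\<close>. The result
  exposes the longest letter on the right; the next lemma exposes it on the left.
\<close>

lemma chain_snoc:
  assumes "1 \<le> i" "i < j" "j \<le> n"
  shows "dual_cong n (chain i j) (chain (Suc i) j @ [(i, j)])"
proof -
  have "Suc i \<le> j" using assms by simp
  then show ?thesis using assms(3)
  proof (induction j rule: dec_induct)
    case base
    then show ?case using assms(1) 
      by (simp add: chain_Cons) (simp add: chain_def dual_cong.refl gens_def)
  next
    case (step j)
    have "dual_cong n (chain i j @ [(j, Suc j)]) ((chain (Suc i) j @ [(i, j)]) @ [(j, Suc j)])"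
      using step by (intro dual_cong_appendR) (auto simp: gens_def)
    also have "dual_cong n (chain (Suc i) j @ [(i, j), (j, Suc j)])
       (chain (Suc i) j @ [(j, Suc j), (i, Suc j)])"
      using step assms(1) by (intro dual_cong_appendL dual_cong_triangle chain_lists) auto
    then have "dual_cong n ((chain (Suc i) j @ [(i, j)]) @ [(j, Suc j)])
       (chain (Suc i) j @ [(j, Suc j), (i, Suc j)])" by simp
    finally show ?case using step by (simp add: chain_Suc)
  qed
qed

lemma chain_hull_Cons:
  assumes "1 \<le> i" "i \<le> j" "Suc j \<le> n"
  shows "dual_cong n (chain i (Suc j)) ((i, Suc j) # chain i j)"
  using assms(2,3)
proof (induction j rule: dec_induct)
  case base
  then show ?case using assms(1) 
    by (simp add: chain_Cons) (simp add: chain_def dual_cong.refl gens_def)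
next
  case (step j)
  let ?l = "(Suc j, Suc (Suc j))"
  have "dual_cong n (chain i (Suc j) @ [?l]) (((i, Suc j) # chain i j) @ [?l])"
    using step by (intro dual_cong_appendR) (auto simp: gens_def)
  also have "dual_cong n (chain i j @ [?l]) (?l # chain i j)"
    using step assms(1) by (intro dual_cong.sym[OF dual_cong_commute] chain_lists)
      (auto simp: gens_def chain_def)
  then have "dual_cong n ([(i, Suc j)] @ chain i j @ [?l]) ([(i, Suc j)] @ ?l # chain i j)"
    using step assms(1) by (intro dual_cong_appendL) (auto simp: gens_def)
  then have "dual_cong n (((i, Suc j) # chain i j) @ [?l]) ([(i, Suc j), ?l] @ chain i j)" by simp
  also have "dual_cong n ([(i, Suc j), ?l] @ chain i j) ([(i, Suc (Suc j)), (i, Suc j)] @ chain i j)"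
    using step assms(1) by (intro dual_cong_appendR dual_cong_triangle chain_lists) auto
  also have "dual_cong n ([(i, Suc (Suc j))] @ (i, Suc j) # chain i j)
     ([(i, Suc (Suc j))] @ chain i (Suc j))"
    using step assms(1) 
    by (intro dual_cong_appendL dual_cong.sym[OF step.IH]) (auto simp: gens_def)
  then have "dual_cong n ([(i, Suc (Suc j)), (i, Suc j)] @ chain i j)
     ([(i, Suc (Suc j))] @ chain i (Suc j))" by simp
  finally show ?case using step by (simp add: chain_Suc)
qed

text \<open>
  Exposing \<open>a\<^bsub>p,q+1\<^esub>\<close> on the left gives
  \<open>chain p (q + 1) = a\<^bsub>p+1,q+1\<^esub> a\<^bsub>p,q+1\<^esub> E\<close> where \<open>E = chain (p + 1) q\<close>, and \<open>E a\<^bsub>p,q\<^esub> = chain p q\<close>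
  collapses the product with \<open>a\<^bsub>p,q\<^esub>\<close> to \<open>a\<^bsub>p+1,q+1\<^esub> a\<^bsub>p,q+1\<^esub> (chain p q)\<close>, which is
  \<open>a\<^bsub>p+1,q+1\<^esub>\<close> times the chain again.
\<close>

lemma chain_conj:
  assumes "1 \<le> p" "p < q" "Suc q \<le> n"
  shows "dual_cong n (chain p (Suc q) @ [(p, q)]) ((Suc p, Suc q) # chain p (Suc q))"
proof -
  let ?E = "chain (Suc p) q"
  have E: "?E \<in> lists (gens n)" "(p, q) \<in> gens n" "(Suc p, Suc q) \<in> gens n" "(p, Suc q) \<in> gens n"
    "(p, Suc p) \<in> gens n"
    using assms chain_lists by (auto simp: gens_def)
  have 1: "dual_cong n (chain p (Suc q)) ([(Suc p, Suc q), (p, Suc q)] @ ?E)"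
  proof -
    have "chain p (Suc q) = [(p, Suc p)] @ chain (Suc p) (Suc q)" using assms by (simp add: chain_Cons)
    also have "dual_cong n \<dots> ([(p, Suc p)] @ (Suc p, Suc q) # ?E)"
      using assms E by (intro dual_cong_appendL chain_hull_Cons) auto
    also have "[(p, Suc p)] @ (Suc p, Suc q) # ?E = [(p, Suc p), (Suc p, Suc q)] @ ?E" by simp
    also have "dual_cong n \<dots> ([(Suc p, Suc q), (p, Suc q)] @ ?E)"
      using assms E by (intro dual_cong_appendR dual_cong_triangle) auto
    finally show ?thesis .
  qed
  have "dual_cong n (chain p (Suc q) @ [(p, q)]) (([(Suc p, Suc q), (p, Suc q)] @ ?E) @ [(p, q)])"
    using E by (intro dual_cong_appendR 1) auto
  also have "([(Suc p, Suc q), (p, Suc q)] @ ?E) @ [(p, q)]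
     = [(Suc p, Suc q), (p, Suc q)] @ ?E @ [(p, q)]" by simp
  also have "dual_cong n \<dots> ([(Suc p, Suc q), (p, Suc q)] @ chain p q)"
    using assms E by (intro dual_cong_appendL dual_cong.sym[OF chain_snoc]) auto
  also have "[(Suc p, Suc q), (p, Suc q)] @ chain p q = [(Suc p, Suc q)] @ (p, Suc q) # chain p q"
    by simp
  also have "dual_cong n \<dots> ([(Suc p, Suc q)] @ chain p (Suc q))"
    using assms E by (intro dual_cong_appendL dual_cong.sym[OF chain_hull_Cons]) auto
  finally show ?thesis by simp
qed

text \<open>
  Conjugation by the Garside element is the rotation. For \<open>q < n\<close> only the strands \<open>p, \<dots>, q + 1\<close>
  interact with the letter, and \<open>chain_conj\<close> applies to them; the remaining letters of
  \<open>\<delta>\<close> commute with it or with its image.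
\<close>

lemma delta_conj:
  assumes "a \<in> gens n"
  shows "dual_cong n (delta n @ [a]) (rot n a # delta n)"
proof -
  obtain p q where a: "a = (p, q)" by fastforce
  then have pq: "1 \<le> p" "p < q" "q \<le> n" using assms by (auto simp: gens_def)
  show ?thesis
  proof (cases "q < n")
    case True
    have d: "delta n = chain 1 p @ chain p (Suc q) @ chain (Suc q) n"
      using pq True by (simp flip: chain_append)
    have l: "chain 1 p \<in> lists (gens n)" "chain p (Suc q) \<in> lists (gens n)"
      "chain (Suc q) n \<in> lists (gens n)"
      using pq True by (simp_all only: chain_lists)
    have "dual_cong n (chain (Suc q) n @ [(p, q)]) ((p, q) # chain (Suc q) n)"
      using assms l pq by (intro dual_cong.sym[OF dual_cong_commute]) (auto simp: a chain_def)
    then have "dual_cong n (delta n @ [a])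
        (chain 1 p @ chain p (Suc q) @ [(p, q)] @ chain (Suc q) n)"
      unfolding d a append_assoc append_Cons append_Nil using l by (intro dual_cong_appendL)
    also have "chain 1 p @ chain p (Suc q) @ [(p, q)] @ chain (Suc q) n
      = chain 1 p @ (chain p (Suc q) @ [(p, q)]) @ chain (Suc q) n" by simp
    also have "dual_cong n \<dots> (chain 1 p @ ((Suc p, Suc q) # chain p (Suc q)) @ chain (Suc q) n)"
      using pq True l by (intro dual_cong_appendL dual_cong_appendR chain_conj) auto
    also have "chain 1 p @ ((Suc p, Suc q) # chain p (Suc q)) @ chain (Suc q) n
      = (chain 1 p @ [(Suc p, Suc q)]) @ chain p (Suc q) @ chain (Suc q) n" by simp
    also have "dual_cong n \<dots> (((Suc p, Suc q) # chain 1 p) @ chain p (Suc q) @ chain (Suc q) n)"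
      using pq True l by (intro dual_cong_appendR dual_cong.sym[OF dual_cong_commute])
        (auto simp: gens_def chain_def)
    finally show ?thesis using True unfolding d a by (simp add: rot_def)
  next
    case False
    then have q: "q = n" using pq by simp
    have d: "delta n = chain 1 (Suc p) @ chain (Suc p) n"
      using pq q by (simp flip: chain_append)
    have l: "chain 1 p \<in> lists (gens n)" "chain 1 (Suc p) \<in> lists (gens n)"
      "chain (Suc p) n \<in> lists (gens n)"
      using pq q by (simp_all only: chain_lists)
    have "dual_cong n (chain 1 (Suc p) @ chain (Suc p) n @ [(p, n)]) (chain 1 (Suc p) @ chain p n)"
      using pq q l by (intro dual_cong_appendL dual_cong.sym[OF chain_snoc]) auto
    also have "chain 1 (Suc p) @ chain p n = chain 1 (Suc p) @ [(p, Suc p)] @ chain (Suc p) n"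
      using pq q by (simp add: chain_Cons)
    also have "dual_cong n \<dots> (((1, Suc p) # chain 1 p) @ [(p, Suc p)] @ chain (Suc p) n)"
      using pq q l by (intro dual_cong_appendR chain_hull_Cons) (auto simp: gens_def)
    also have "((1, Suc p) # chain 1 p) @ [(p, Suc p)] @ chain (Suc p) n
      = (1, Suc p) # chain 1 (Suc p) @ chain (Suc p) n"
      using pq by (simp add: chain_Suc)
    finally show ?thesis using q unfolding d a by (simp add: rot_def)
  qed
qed

text \<open>
  The letter \<open>a\<^bsub>p,q\<^esub>\<close> is exposed at the right end of the chain up to \<open>q\<close> and then carried to the right
  end whenever the chain grows.
\<close>

lemma letter_divides_delta:
  assumes "a \<in> gens n"
  shows "right_div n [a] (delta n)"
proof -
  obtain p q where a: "a = (p, q)" by fastforce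
  then have pq: "1 \<le> p" "p < q" "q \<le> n" using assms by (auto simp: gens_def)
  show ?thesis using pq(3) unfolding a
  proof (induction n rule: dec_induct)
    case base
    have "dual_cong q (chain 1 p @ chain p q) (chain 1 p @ chain (Suc p) q @ [(p, q)])"
      using pq by (intro dual_cong_appendL chain_snoc chain_lists) auto
    then have "dual_cong q (delta q) ((chain 1 p @ chain (Suc p) q) @ [(p, q)])"
      using pq by (simp flip: chain_append)
    then show ?case unfolding right_div_def by blast
  next
    case (step n)
    let ?l = "(n, Suc n)"
    obtain X where X: "dual_cong n (delta n) (X @ [(p, q)])"
      using step.IH unfolding right_div_def by blast
    have l: "?l \<in> gens (Suc n)" using step pq by (auto simp: gens_def)
    have X': "dual_cong (Suc n) (delta n) (X @ [(p, q)])" using dual_cong_mono[OF X] by simp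
    have "dual_cong (Suc n) (delta n @ [?l]) ((X @ [(p, q)]) @ [?l])"
      using l by (intro dual_cong_appendR X') auto
    (* The letter passes over the new last letter of the Garside word, which may change. *)
    moreover have "\<exists>b. dual_cong (Suc n) [(p, q), ?l] [b, (p, q)]"
    proof (cases "q < n")
      case True
      then show ?thesis using pq by (auto intro!: exI dual_cong.base dual_rel.comm simp: gens_def)
    next
      case False
      then have "q = n" using step by simp
      then show ?thesis using pq dual_cong_triangle(3)[of p n "Suc n" "Suc n"] by auto
    qed
    then obtain b where b: "dual_cong (Suc n) [(p, q), ?l] [b, (p, q)]" by blast
    have "dual_cong (Suc n) (X @ [(p, q), ?l]) (X @ [b, (p, q)])"
      using b dual_cong_lists[OF X'] by (intro dual_cong_appendL) auto
    ultimately have "dual_cong (Suc n) (delta n @ [?l]) ((X @ [b]) @ [(p, q)])"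
      using dual_cong.trans by fastforce
    then have "dual_cong (Suc n) (delta (Suc n)) ((X @ [b]) @ [(p, q)])"
      using step pq chain_Suc[of 1 n] by simp
    then show ?case unfolding right_div_def by blast
  qed
qed

section \<open>Tracking the simple right divisors of a word\<close>

text \<open>
  The simple right divisors of a braid, as words. They are the right divisors of its greatest
  common right divisor with the Garside element.
\<close>

definition simple_tails :: "nat \<Rightarrow> word \<Rightarrow> word set" where
  "simple_tails n w = {s. right_div n s (delta n) \<and> right_div n s w}"

text \<open>
  A right divisor of \<open>\<delta>\<close> stays one when its last letter is removed: from \<open>\<delta> = Z q a\<close> and
  \<open>\<delta> a = a' \<delta>\<close> follows \<open>\<delta> a = a' Z q a\<close>, and \<open>a\<close> cancels.
\<close>

lemma cofactor_divides_delta: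
  assumes "right_div n (q @ [a]) (delta n)"
  shows "right_div n q (delta n)"
proof -
  have a: "a \<in> gens n" using right_div_lists[OF assms] by simp
  obtain Z where Z: "dual_cong n (delta n) (Z @ q @ [a])"
    using assms unfolding right_div_def by blast
  have r: "rot n a \<in> gens n" using a by (rule rot_gens)
  have "dual_cong n (delta n @ [a]) ([rot n a] @ delta n)" using delta_conj[OF a] by simp
  also have "dual_cong n ([rot n a] @ delta n) ([rot n a] @ Z @ q @ [a])"
    using r by (intro dual_cong_appendL Z) auto
  finally have "dual_cong n (delta n @ [a]) (([rot n a] @ Z @ q) @ [a])" by simp
  then have "dual_cong n (delta n) ((rot n a # Z) @ q)" using dual_cong_cancel by fastforce
  then show ?thesis unfolding right_div_def by blast
qed

text \<open>
  The right-hand side mentions \<open>w\<close> only through \<open>simple_tails n w\<close>: this is the transition function of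
  a finite automaton.
\<close>

lemma simple_tails_snoc:
  assumes "w \<in> lists (gens n)" "a \<in> gens n"
  shows "simple_tails n (w @ [a])
    = {s. right_div n s (delta n) \<and> (\<exists>t\<in>simple_tails n w. right_div n s (t @ [a]))}"
proof (intro equalityI subsetI)
  fix s assume "s \<in> simple_tails n (w @ [a])"
  then have s: "right_div n s (delta n)" "right_div n s (w @ [a])" by (auto simp: simple_tails_def)
  obtain X where X: "dual_cong n (X @ s) (w @ [a])"
    using s(2) unfolding right_div_def by (blast intro: dual_cong.sym)
  obtain Y Y' where Y: "dual_cong n (delta n) (Y @ s)" "dual_cong n (delta n) (Y' @ [a])"
    using s(1) letter_divides_delta[OF assms(2)] unfolding right_div_def by blast
  then have YY: "dual_cong n (Y @ s) (Y' @ [a])" by (blast intro: dual_cong.sym dual_cong.trans)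
  obtain p q where pq: "dual_cong n (p @ s) (q @ [a])"
    and univ: "\<forall>X Y. dual_cong n (X @ s) (Y @ [a]) \<longrightarrow>
       (\<exists>Z. dual_cong n X (Z @ p) \<and> dual_cong n Y (Z @ q))"
    using words_lcm[OF X] by blast
  have "right_div n q w" using univ X unfolding right_div_def by blast
  moreover have "right_div n q Y'" using univ YY unfolding right_div_def by blast
  then have "right_div n (q @ [a]) (delta n)"
    using assms(2) by (intro right_div_cong[OF right_div_append dual_cong.sym[OF Y(2)]]) auto
  then have "right_div n q (delta n)" by (rule cofactor_divides_delta)
  moreover have "right_div n s (q @ [a])"
    using pq unfolding right_div_def by (blast intro: dual_cong.sym)
  ultimately show "s \<in> {s. right_div n s (delta n) \<and> (\<exists>t\<in>simple_tails n w. right_div n s (t @ [a]))}"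
    using s(1) by (auto simp: simple_tails_def)
next
  fix s assume "s \<in> {s. right_div n s (delta n) \<and> (\<exists>t\<in>simple_tails n w. right_div n s (t @ [a]))}"
  then obtain t where t: "right_div n s (delta n)" "right_div n t w" "right_div n s (t @ [a])"
    by (auto simp: simple_tails_def)
  have "right_div n (t @ [a]) (w @ [a])" using t(2) assms(2) by (intro right_div_append) auto
  then show "s \<in> simple_tails n (w @ [a])"
    using t(1,3) right_div_trans unfolding simple_tails_def by blast
qed

lemma finite_gens: "finite (gens n)"
  by (rule finite_subset[of _ "{..n} \<times> {..n}"]) (auto simp: gens_def)

lemma finite_range_simple_tails: "finite (range (simple_tails n))"
proof -
  let ?S = "{s. set s \<subseteq> gens n \<and> length s \<le> length (delta n)}"
  have "finite ?S" using finite_gens by (rule finite_lists_length_le)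
  moreover have "simple_tails n w \<subseteq> ?S" for w
  proof
    fix s assume "s \<in> simple_tails n w"
    then have s: "right_div n s (delta n)" by (simp add: simple_tails_def)
    then obtain X where "dual_cong n (delta n) (X @ s)" unfolding right_div_def by blast
    then have "length s \<le> length (delta n)" using dual_cong_length by fastforce
    then show "s \<in> ?S" using right_div_lists[OF s] by auto
  qed
  then have "range (simple_tails n) \<subseteq> Pow ?S" by blast
  ultimately show ?thesis by (meson finite_Pow_iff finite_subset)
qed

lemma letter_in_simple_tails: "[a] \<in> simple_tails n w \<longleftrightarrow> right_div n [a] w"
proof
  assume a: "right_div n [a] w"
  then have "a \<in> gens n" using right_div_lists by fastforce
  then show "[a] \<in> simple_tails n w"
    using a letter_divides_delta by (simp add: simple_tails_def)
qed (simp add: simple_tails_def)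

section \<open>Rotation\<close>

lemma rot_shift: "q + k \<le> n \<Longrightarrow> (rot n ^^ k) (p, q) = (p + k, q + k)"
  by (induction k) (auto simp: rot_def)

text \<open>
  Follow the letter around the circle: \<open>(p, q)\<close> moves to \<open>(p + n - q, n)\<close>, wraps to
  \<open>(1, p + n - q + 1)\<close>, moves to \<open>(q - p, n)\<close>, wraps to \<open>(1, q - p + 1)\<close> and moves back to \<open>(p, q)\<close>.
\<close>

lemma rot_period:
  assumes "a \<in> gens n"
  shows "(rot n ^^ n) a = a"
proof -
  obtain p q where a: "a = (p, q)" by fastforce
  have pq: "1 \<le> p" "p < q" "q \<le> n" using assms by (auto simp: a gens_def)
  have n: "n = (p - 1) + Suc ((q - p - 1) + Suc (n - q))" using pq by simp
  have 1: "(rot n ^^ (n - q)) (p, q) = (p + n - q, n)" using pq rot_shift[of q "n - q"] by simp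
  have 2: "(rot n ^^ (q - p - 1)) (1, p + n - q + 1) = (q - p, n)"
    using pq rot_shift[of "p + n - q + 1" "q - p - 1" n 1] by simp
  have 3: "(rot n ^^ (p - 1)) (1, q - p + 1) = (p, q)"
    using pq rot_shift[of "q - p + 1" "p - 1" n 1] by simp
  have r: "rot n (x, n) = (1, x + 1)" for x by (simp add: rot_def)
  have "(rot n ^^ ((p - 1) + Suc ((q - p - 1) + Suc (n - q)))) (p, q) = (p, q)"
    by (simp only: funpow_add funpow.simps o_apply 1 r 2 3)
  then show ?thesis unfolding n[symmetric] a .
qed

lemma rot_pow_gens: "a \<in> gens n \<Longrightarrow> (rot n ^^ m) a \<in> gens n"
  by (induction m) (auto intro: rot_gens)

lemma map_rot_pow_lists: "w \<in> lists (gens n) \<Longrightarrow> map (rot n ^^ m) w \<in> lists (gens n)"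
  using rot_pow_gens by auto

lemma rot_pow_mult_period: "a \<in> gens n \<Longrightarrow> (rot n ^^ (m * n)) a = a"
  by (induction m) (simp_all add: funpow_add rot_period)

lemma rot_pow_mod:
  assumes "a \<in> gens n"
  shows "(rot n ^^ m) a = (rot n ^^ (m mod n)) a"
proof -
  have "(rot n ^^ (m mod n + m div n * n)) a = (rot n ^^ (m mod n)) a"
    unfolding funpow_add using rot_pow_mult_period[OF assms] by simp
  then show ?thesis by simp
qed

lemma map_rot_pow_mod: "w \<in> lists (gens n) \<Longrightarrow> map (rot n ^^ m) w = map (rot n ^^ (m mod n)) w"
  by (auto intro: rot_pow_mod)

lemma dual_cong_rot_pow: "dual_cong n u v \<Longrightarrow> dual_cong n (map (rot n ^^ m) u) (map (rot n ^^ m) v)"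
proof (induction m)
  case (Suc m)
  then show ?case using dual_cong_rot[of n "map (rot n ^^ m) u" "map (rot n ^^ m) v"] by (simp add: comp_def)
qed simp

lemma map_rot_inverse:
  assumes "w \<in> lists (gens n)"
  shows "map (rot n ^^ (n - 1)) (map (rot n) w) = w" "map (rot n) (map (rot n ^^ (n - 1)) w) = w"
proof -
  have "(rot n ^^ (n - 1)) (rot n a) = a \<and> rot n ((rot n ^^ (n - 1)) a) = a" if "a \<in> gens n" for a
  proof -
    have n: "n = Suc (n - 1)" using that by (auto simp: gens_def)
    have "(rot n ^^ Suc (n - 1)) a = a" using rot_period[OF that] n by simp
    then show ?thesis using funpow_swap1[of "rot n" "n - 1" a] by simp
  qed
  then show "map (rot n ^^ (n - 1)) (map (rot n) w) = w" "map (rot n) (map (rot n ^^ (n - 1)) w) = w"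
    using assms by (auto intro!: map_idI)
qed

lemma dual_cong_rot_cancel:
  assumes "dual_cong n (map (rot n) u) (map (rot n) v)" "u \<in> lists (gens n)" "v \<in> lists (gens n)"
  shows "dual_cong n u v"
  using dual_cong_rot_pow[OF assms(1), of "n - 1"] map_rot_inverse(1) assms(2,3) by simp

lemma right_div_rot_cancel:
  assumes "right_div n (map (rot n) s) (map (rot n) w)" "s \<in> lists (gens n)" "w \<in> lists (gens n)"
  shows "right_div n s w"
proof -
  obtain X where X: "dual_cong n (map (rot n) w) (X @ map (rot n) s)"
    using assms(1) unfolding right_div_def by blast
  have "X \<in> lists (gens n)" using dual_cong_lists[OF X] by simp
  then have "dual_cong n w (map (rot n ^^ (n - 1)) X @ s)"
    using dual_cong_rot_pow[OF X, of "n - 1"] map_rot_inverse(1) assms(2,3) by simp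
  then show ?thesis unfolding right_div_def by blast
qed

section \<open>Splittings of words\<close>

lemma gens_mono: "m \<le> n \<Longrightarrow> gens m \<subseteq> gens n"
  by (auto simp: gens_def)

text \<open>
  The tail of \<open>w\<close> is trivial. Testing letters is enough, since a nontrivial divisor from
  the smaller monoid ends in a letter.
\<close>

definition no_tail :: "nat \<Rightarrow> word \<Rightarrow> bool" where
  "no_tail n w \<longleftrightarrow> (\<forall>a\<in>gens (n - 1). \<not> right_div n [a] w)"

lemma no_tail_cong: "no_tail n u \<Longrightarrow> dual_cong n u v \<Longrightarrow> no_tail n v"
  unfolding no_tail_def using right_div_cong dual_cong.sym by blast

lemma no_tail_Nil: "no_tail n []"
  unfolding no_tail_def using right_div_Nil by blast

lemma no_tail_right_div:
  assumes "no_tail n w" "right_div n s w" "s \<in> lists (gens (n - 1))"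
  shows "s = []"
proof (cases s rule: rev_cases)
  case (snoc s' a)
  then have "right_div n [a] s"
    using right_div_suffix right_div_lists[OF assms(2)] by blast
  then have "right_div n [a] w" using assms(2) right_div_trans by blast
  then show ?thesis using assms(1,3) snoc unfolding no_tail_def by simp
qed simp

lemma rot_concat_lists: "set ws \<subseteq> lists (gens n) \<Longrightarrow> rot_concat n m ws \<in> lists (gens n)"
proof (induction ws arbitrary: m)
  case (Cons w ws)
  then have "rot_concat n (Suc m) ws \<in> lists (gens n)" "w \<in> lists (gens n)" by simp_all
  then show ?case using map_rot_pow_lists[of w n m] by simp
qed simp

lemma rot_concat_Suc: "rot_concat n (Suc m) ws = map (rot n) (rot_concat n m ws)"
  by (induction ws arbitrary: m) simp_all

lemma rot_concat_cong:
  "list_all2 (dual_cong n) us vs \<Longrightarrow> dual_cong n (rot_concat n m us) (rot_concat n m vs)"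
  by (induction us vs arbitrary: m rule: list_all2_induct)
    (simp_all add: dual_cong.refl dual_cong.append dual_cong_rot_pow)

text \<open>
  Splittings on the level of words, in recursive form. As in \<^const>\<open>is_splitting\<close>, the head of the
  list is the rightmost factor.
\<close>

primrec word_splitting :: "nat \<Rightarrow> word list \<Rightarrow> bool" where
  "word_splitting n [] \<longleftrightarrow> False"
| "word_splitting n (w # ws) \<longleftrightarrow> w \<in> lists (gens (n - 1)) \<and>
     (if ws = [] then w \<noteq> [] else no_tail n (rot_concat n 1 ws) \<and> word_splitting n ws)"

lemma word_splitting_subset: "word_splitting n ws \<Longrightarrow> set ws \<subseteq> lists (gens (n - 1))"
  by (induction ws) (auto split: if_splits)

lemma word_splitting_lists: "word_splitting n ws \<Longrightarrow> rot_concat n m ws \<in> lists (gens n)"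
  using order.trans[OF word_splitting_subset lists_mono[OF gens_mono]]
  by (intro rot_concat_lists) simp

lemma word_splitting_nonempty: "word_splitting n ws \<Longrightarrow> rot_concat n m ws \<noteq> []"
  by (induction ws arbitrary: m) (auto split: if_splits)

lemma word_splitting_cong:
  assumes "list_all2 (dual_cong (n - 1)) us vs" "word_splitting n us"
  shows "word_splitting n vs"
  using assms
proof (induction us vs rule: list_all2_induct)
  case (Cons u us v vs)
  have uv: "v \<in> lists (gens (n - 1))" "u = [] \<longleftrightarrow> v = []" "us = [] \<longleftrightarrow> vs = []"
    using Cons.hyps dual_cong_lists dual_cong_length[OF Cons.hyps(1)] by auto
  have "list_all2 (dual_cong n) us vs"
    using Cons.hyps(2) by (rule list_all2_mono) (erule dual_cong_mono, simp)
  then have "dual_cong n (rot_concat n 1 us) (rot_concat n 1 vs)" by (rule rot_concat_cong)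
  then show ?case using Cons.IH Cons.prems uv no_tail_cong by (auto split: if_splits)
qed simp

text \<open>
  If \<open>p u = q v\<close> is the least common multiple of \<open>u\<close> and \<open>v\<close>, then \<open>p\<close> and \<open>q\<close> lie in the smaller
  monoid and divide \<open>X\<close> and \<open>Y\<close>, so they are trivial.
\<close>

lemma tail_unique:
  assumes "dual_cong n (X @ u) (Y @ v)" "u \<in> lists (gens (n - 1))" "v \<in> lists (gens (n - 1))"
    and "no_tail n X" "no_tail n Y"
  shows "dual_cong n u v" "dual_cong n X Y"
proof -
  obtain p q where pq: "dual_cong n (p @ u) (q @ v)"
    and l: "p \<in> lists (gens (n - 1))" "q \<in> lists (gens (n - 1))"
    and univ: "\<exists>Z. dual_cong n X (Z @ p) \<and> dual_cong n Y (Z @ q)"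
    using words_lcm[OF assms(1)] assms(1-3) by blast
  obtain Z where Z: "dual_cong n X (Z @ p)" "dual_cong n Y (Z @ q)" using univ by blast
  have "p = []" "q = []"
    using no_tail_right_div[OF assms(4) _ l(1)] no_tail_right_div[OF assms(5) _ l(2)] Z
    unfolding right_div_def by blast+
  then show "dual_cong n u v" "dual_cong n X Y"
    using pq Z(1) dual_cong.trans[OF Z(1) dual_cong.sym] Z(2) by simp_all
qed

text \<open>
  The rightmost factor is determined as a tail, and the rest is rotated back. Whether anything is left
  is visible from the length, because the leftmost factor of a splitting is nontrivial.
\<close>

lemma word_splitting_unique:
  assumes "word_splitting n us" "word_splitting n vs"
    and "dual_cong n (rot_concat n 0 us) (rot_concat n 0 vs)"
  shows "list_all2 (dual_cong n) us vs"
  using assms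
proof (induction us arbitrary: vs)
  case (Cons u us)
  obtain v vs' where vs: "vs = v # vs'" using Cons.prems(2) by (cases vs) auto
  have nt: "no_tail n (rot_concat n 1 us)" "no_tail n (rot_concat n 1 vs')"
    using Cons.prems(1,2) no_tail_Nil unfolding vs by (cases "us = []"; cases "vs' = []"; simp)+
  have eq: "dual_cong n (rot_concat n 1 us @ u) (rot_concat n 1 vs' @ v)"
    using Cons.prems(3) by (simp add: vs)
  have l: "u \<in> lists (gens (n - 1))" "v \<in> lists (gens (n - 1))"
    using Cons.prems(1,2) by (simp_all add: vs)
  have uv: "dual_cong n u v" and rest: "dual_cong n (rot_concat n 1 us) (rot_concat n 1 vs')"
    by (rule tail_unique[OF eq l nt])+
  show ?case
  proof (cases "us = [] \<or> vs' = []")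
    case True
    have "length (rot_concat n 1 us) = length (rot_concat n 1 vs')"
      using rest by (rule dual_cong_length)
    moreover have "rot_concat n 1 us \<noteq> []" if "us \<noteq> []"
      using that Cons.prems(1) by (intro word_splitting_nonempty) simp
    moreover have "rot_concat n 1 vs' \<noteq> []" if "vs' \<noteq> []"
      using that Cons.prems(2) by (intro word_splitting_nonempty) (simp add: vs)
    moreover have "rot_concat n 1 [] = []" by simp
    ultimately have "us = [] \<and> vs' = []" using True by (metis length_0_conv)
    then show ?thesis using uv by (simp add: vs)
  next
    case False
    then have s: "word_splitting n us" "word_splitting n vs'"
      using Cons.prems(1,2) by (simp_all add: vs)
    have "dual_cong n (map (rot n) (rot_concat n 0 us)) (map (rot n) (rot_concat n 0 vs'))"
      using rest by (simp add: rot_concat_Suc)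
    then have "dual_cong n (rot_concat n 0 us) (rot_concat n 0 vs')"
      using s[THEN word_splitting_lists] by (rule dual_cong_rot_cancel)
    then have "list_all2 (dual_cong n) us vs'" using Cons.IH s by blast
    then show ?thesis using uv by (simp add: vs)
  qed
qed simp

lemma tail_exists:
  assumes "w \<in> lists (gens n)"
  shows "\<exists>X u. dual_cong n w (X @ u) \<and> u \<in> lists (gens (n - 1)) \<and> no_tail n X"
  using assms
proof (induction "length w" arbitrary: w rule: less_induct)
  case less
  show ?case
  proof (cases "no_tail n w")
    case True
    then show ?thesis using dual_cong.refl[OF less.prems]
      by (intro exI[of _ w] exI[of _ "[]"]) simp
  next
    case False
    then obtain a X where a: "a \<in> gens (n - 1)" "dual_cong n w (X @ [a])"
      unfolding no_tail_def right_div_def by blast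
    have aX: "[a] \<in> lists (gens n)" "X \<in> lists (gens n)" "length X < length w"
      using dual_cong_lists[OF a(2)] dual_cong_length[OF a(2)] by simp_all
    obtain Y u where Y: "dual_cong n X (Y @ u)" "u \<in> lists (gens (n - 1))" "no_tail n Y"
      using less.hyps[OF aX(3,2)] by blast
    have "dual_cong n w (Y @ u @ [a])"
      using dual_cong.trans[OF a(2) dual_cong_appendR[OF Y(1) aX(1)]] by simp
    then show ?thesis using Y a(1) by (intro exI[of _ Y] exI[of _ "u @ [a]"]) simp
  qed
qed

text \<open>
  The number of inverse rotations that bring a letter into the smaller alphabet: none
  for \<open>a\<^bsub>p,q\<^esub>\<close> with \<open>q < n\<close>, one for \<open>a\<^bsub>p,n\<^esub>\<close> with \<open>p > 1\<close>, and two for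
  \<open>a\<^bsub>1,n\<^esub>\<close>, which comes from \<open>a\<^bsub>n-1,n\<^esub>\<close>.
\<close>

definition letter_rank :: "nat \<Rightarrow> letter \<Rightarrow> nat" where
  "letter_rank n a = (if snd a < n then 0 else if fst a = 1 then 2 else 1)"

lemma unrotate_letter:
  assumes "n \<ge> 3" "a \<in> gens n" "a \<notin> gens (n - 1)"
  shows "\<exists>b\<in>gens n. rot n b = a \<and> letter_rank n b < letter_rank n a"
proof -
  obtain p where a: "a = (p, n)" "1 \<le> p" "p < n"
    using assms(2,3) by (force simp: gens_def)
  show ?thesis
  proof (cases "p = 1")
    case True
    then show ?thesis using a assms(1)
      by (intro bexI[of _ "(n - 1, n)"]) (auto simp: rot_def letter_rank_def gens_def)
  next
    case False
    then show ?thesis using a assms(1)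
      by (intro bexI[of _ "(p - 1, n - 1)"]) (auto simp: rot_def letter_rank_def gens_def)
  qed
qed

text \<open>
  Split off the tail, rotate the rest back and repeat. The rest need not become shorter, because a
  tail can be trivial; but then the rank of a letter dividing on the right drops. The factor 3 in the measure
  exceeds every rank, so a loss of length outweighs any gain of rank.
\<close>

lemma word_splitting_exists_right_div:
  assumes "n \<ge> 3" "right_div n [a] w"
  shows "\<exists>ws. word_splitting n ws \<and> dual_cong n w (rot_concat n 0 ws)"
  using assms(2)
proof (induction "3 * length w + letter_rank n a" arbitrary: w a rule: less_induct)
  case less
  have a: "a \<in> gens n" using right_div_lists[OF less.prems] by simp
  have w: "w \<in> lists (gens n)"
    using less.prems dual_cong_lists unfolding right_div_def by blast
  obtain X u where X: "dual_cong n w (X @ u)" and u: "u \<in> lists (gens (n - 1))"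
    and nt: "no_tail n X" using tail_exists[OF w] by blast
  have Xl: "X \<in> lists (gens n)" and un: "u \<in> lists (gens n)" using dual_cong_lists[OF X] by auto
  have len: "length w = length X + length u" using dual_cong_length[OF X] by simp
  show ?case
  proof (cases "X = []")
    case True
    have "w \<noteq> []" using less.prems right_div_Nil by blast
    then have "word_splitting n [u]" using True u len by auto
    then show ?thesis using X True by (intro exI[of _ "[u]"]) simp
  next
    case False
    define Y where "Y = map (rot n ^^ (n - 1)) X"
    have Y: "map (rot n) Y = X" "Y \<in> lists (gens n)" "length Y = length X"
      unfolding Y_def using map_rot_inverse(2)[OF Xl] map_rot_pow_lists[OF Xl] by simp_all
    obtain b where b: "right_div n [b] Y"
        "3 * length Y + letter_rank n b < 3 * length w + letter_rank n a"
    proof (cases "u = []")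
      case True
      then have aX: "right_div n [a] X" using less.prems X right_div_cong by simp
      then have "a \<notin> gens (n - 1)" using nt by (auto simp: no_tail_def)
      then obtain b where b: "b \<in> gens n" "rot n b = a" "letter_rank n b < letter_rank n a"
        using unrotate_letter[OF assms(1) a] by blast
      then have "right_div n [b] Y"
        using right_div_rot_cancel[of n "[b]" Y] aX Y by simp
      then show ?thesis using that b(3) True len Y(3) by simp
    next
      case False
      obtain Y' b where b: "Y = Y' @ [b]" using \<open>X \<noteq> []\<close> Y(3) by (cases Y rule: rev_cases) auto
      then have "right_div n [b] Y" using right_div_suffix Y(2) by simp
      moreover have "letter_rank n b \<le> 2" by (simp add: letter_rank_def)
      then have "3 * length Y + letter_rank n b < 3 * length w + letter_rank n a"
        using False len Y(3) by (cases u) auto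
      ultimately show ?thesis using that by blast
    qed
    obtain ws where ws: "word_splitting n ws" "dual_cong n Y (rot_concat n 0 ws)"
      using less.hyps[OF b(2,1)] by blast
    have Xws: "dual_cong n X (rot_concat n 1 ws)"
      using dual_cong_rot[OF ws(2)] Y(1) by (simp add: rot_concat_Suc)
    have "word_splitting n (u # ws)"
      using ws(1) u no_tail_cong[OF nt Xws] by auto
    moreover have "dual_cong n w (rot_concat n 0 (u # ws))"
      using dual_cong.trans[OF X dual_cong_appendR[OF Xws un]] by simp
    ultimately show ?thesis by blast
  qed
qed

lemma word_splitting_exists:
  assumes "n \<ge> 3" "w \<in> lists (gens n)" "w \<noteq> []"
  shows "\<exists>ws. word_splitting n ws \<and> dual_cong n w (rot_concat n 0 ws)"
proof -
  obtain w' a where "w = w' @ [a]" using assms(3) by (cases w rule: rev_cases) auto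
  then have "right_div n [a] w" using assms(2) right_div_suffix by blast
  then show ?thesis using word_splitting_exists_right_div[OF assms(1)] by blast
qed

section \<open>Splittings of braids\<close>

lemma one_braid_of: "\<one>\<^bsub>dual_braid_monoid n\<^esub> = braid_of n []"
  by (simp add: dual_braid_monoid_def)

lemma carrier_braid_of: "carrier (dual_braid_monoid n) = braid_of n ` lists (gens n)"
  by (simp add: dual_braid_monoid_def)

lemma braid_of_eq_one_iff:
  assumes "w \<in> lists (gens n)" 
  shows "braid_of n w = braid_of n [] \<longleftrightarrow> w = []"
  using braid_of_eq_iff[OF assms] dual_cong_Nil dual_cong.refl[of "[]" n] by auto

lemma one_dual_braid_monoid_pred: "\<one>\<^bsub>dual_braid_monoid (n - 1)\<^esub> = braid_of n []"
  using braid_of_stable[of "[]" "n - 1" n] by (simp add: one_braid_of)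

lemma right_divides_braid_of:
  assumes "s \<in> lists (gens n)" "w \<in> lists (gens n)"
  shows "right_divides n (braid_of n s) (braid_of n w) \<longleftrightarrow> right_div n s w"
proof
  assume "right_divides n (braid_of n s) (braid_of n w)"
  then obtain x where "x \<in> lists (gens n)"
    "braid_of n w = braid_of n x \<otimes>\<^bsub>dual_braid_monoid n\<^esub> braid_of n s"
    unfolding right_divides_def carrier_braid_of by blast
  then have "dual_cong n w (x @ s)" using assms by (simp add: mult_braid_of braid_of_eq_iff del: in_lists_conv_set)
  then show "right_div n s w" unfolding right_div_def by blast
next
  assume "right_div n s w"
  then obtain x where x: "dual_cong n w (x @ s)" unfolding right_div_def by blast
  then have "x \<in> lists (gens n)" using dual_cong_lists by fastforce
  moreover from this have "braid_of n w = braid_of n x \<otimes>\<^bsub>dual_braid_monoid n\<^esub> braid_of n s"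
    using assms braid_of_eqI[OF x] by (simp add: mult_braid_of del: in_lists_conv_set)
  ultimately show "right_divides n (braid_of n s) (braid_of n w)"
    unfolding right_divides_def carrier_braid_of by blast
qed

text \<open>
  Every braid on \<open>n - 1\<close> strands is, as a class of words, also a braid on \<open>n\<close> strands, so a right divisor
  from the smaller monoid is represented by a word over the smaller alphabet.
\<close>

lemma is_tail_one_iff:
  assumes "w \<in> lists (gens n)"
  shows "is_tail n (braid_of n w) \<one>\<^bsub>dual_braid_monoid n\<^esub> \<longleftrightarrow> no_tail n w"
proof
  have sub: "s \<in> lists (gens n)" if "s \<in> lists (gens (n - 1))" for s
    using that gens_mono[of "n - 1" n] by auto
  have carrier: "carrier (dual_braid_monoid (n - 1)) = braid_of n ` lists (gens (n - 1))"
    by (rule carrier_dual_braid_monoid_mono) simp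
  have div_one: "right_divides n (braid_of n []) (braid_of n s)" if "s \<in> lists (gens n)" for s
    using that right_divides_braid_of[of "[]" n s] dual_cong.refl[OF that]
    by (auto simp: right_div_def)
  {
    assume tail: "is_tail n (braid_of n w) \<one>\<^bsub>dual_braid_monoid n\<^esub>"
    show "no_tail n w" unfolding no_tail_def
    proof (intro ballI notI)
      fix a assume a: "a \<in> gens (n - 1)" "right_div n [a] w"
      then have "braid_of n [a] \<in> carrier (dual_braid_monoid (n - 1))" "[a] \<in> lists (gens n)"
        using sub[of "[a]"] carrier by auto
      then have "braid_of n [a] = braid_of n []"
        using tail a(2) right_divides_braid_of assms div_one[of "[a]"]
        unfolding is_tail_def one_braid_of by blast
      then show False using braid_of_eq_one_iff[of "[a]" n] \<open>[a] \<in> lists (gens n)\<close> by simp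
    qed
  next
    assume nt: "no_tail n w"
    have "\<gamma> = braid_of n []"
      if "\<gamma> \<in> carrier (dual_braid_monoid (n - 1))" "right_divides n \<gamma> (braid_of n w)" for \<gamma>
    proof -
      obtain s where s: "s \<in> lists (gens (n - 1))" "\<gamma> = braid_of n s"
        using \<open>\<gamma> \<in> _\<close> carrier by blast
      then have "right_div n s w"
        using that(2) right_divides_braid_of[OF sub[OF s(1)] assms] by simp
      then show ?thesis using no_tail_right_div[OF nt] s by blast
    qed
    moreover have "braid_of n [] \<in> carrier (dual_braid_monoid (n - 1))" using carrier by auto
    ultimately show "is_tail n (braid_of n w) \<one>\<^bsub>dual_braid_monoid n\<^esub>"
      unfolding is_tail_def one_braid_of using div_one[OF assms] by blast
  }
qed

lemma rot_braid_pow_braid_of: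
  "w \<in> lists (gens n) \<Longrightarrow> (rot_braid n ^^ m) (braid_of n w) = braid_of n (map (rot n ^^ m) w)"
proof (induction m)
  case (Suc m)
  then show ?case using rot_braid_of[OF map_rot_pow_lists[OF Suc.prems, of m]]
    by (simp add: comp_def)
qed simp

lemma rot_prod_braid_of:
  "set ws \<subseteq> lists (gens n) \<Longrightarrow> rot_prod n m (map (braid_of n) ws) = braid_of n (rot_concat n m ws)"
proof (induction ws arbitrary: m)
  case (Cons w ws)
  then have "w \<in> lists (gens n)" "rot_concat n (Suc m) ws \<in> lists (gens n)"
    using rot_concat_lists[of ws n "Suc m"] by simp_all
  then show ?case using Cons map_rot_pow_lists[of w n m]
    by (simp add: rot_braid_pow_braid_of mult_braid_of del: in_lists_conv_set)
qed (simp add: one_braid_of)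

lemma word_splitting_iff_drop:
  "word_splitting n ws \<longleftrightarrow> ws \<noteq> [] \<and> set ws \<subseteq> lists (gens (n - 1)) \<and> last ws \<noteq> [] \<and>
     (\<forall>k. 1 \<le> k \<and> k < length ws \<longrightarrow> no_tail n (rot_concat n 1 (drop k ws)))"
proof (induction ws)
  case (Cons w ws)
  have "(\<forall>k. 1 \<le> k \<and> k < length (w # ws) \<longrightarrow> no_tail n (rot_concat n 1 (drop k (w # ws)))) \<longleftrightarrow>
    (\<forall>k < length ws. no_tail n (rot_concat n 1 (drop k ws)))"
    by (auto simp: all_conj_distrib less_Suc_eq_0_disj Suc_le_eq gr0_conv_Suc)
  also have "\<dots> \<longleftrightarrow> ws = [] \<or> no_tail n (rot_concat n 1 ws) \<and>
    (\<forall>k. 1 \<le> k \<and> k < length ws \<longrightarrow> no_tail n (rot_concat n 1 (drop k ws)))"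
    by (metis One_nat_def Suc_leI drop0 gr0I length_0_conv length_greater_0_conv list.size(3) not_less_zero)
  finally show ?case using Cons by auto
qed simp

lemma is_splitting_iff:
  assumes "set ws \<subseteq> lists (gens (n - 1))"
  shows "is_splitting n \<beta> (map (braid_of n) ws) \<longleftrightarrow>
    word_splitting n ws \<and> \<beta> = braid_of n (rot_concat n 0 ws)"
proof -
  have sub: "set ws \<subseteq> lists (gens n)"
    using assms gens_mono[of "n - 1" n] lists_mono[of "gens (n - 1)" "gens n"] by auto
  have carrier: "set (map (braid_of n) ws) \<subseteq> carrier (dual_braid_monoid (n - 1))"
    using assms carrier_dual_braid_monoid_mono(1)[of "n - 1" n] by auto
  have last: "last (map (braid_of n) ws) \<noteq> \<one>\<^bsub>dual_braid_monoid (n - 1)\<^esub> \<longleftrightarrow> last ws \<noteq> []"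
    if "ws \<noteq> []"
  proof -
    have "last ws \<in> lists (gens n)" using that sub last_in_set by blast
    then show ?thesis using that braid_of_eq_one_iff unfolding one_dual_braid_monoid_pred by (simp add: last_map)
  qed
  have tails: "is_tail n (rot_prod n 1 (drop k (map (braid_of n) ws))) \<one>\<^bsub>dual_braid_monoid n\<^esub>
      \<longleftrightarrow> no_tail n (rot_concat n 1 (drop k ws))" for k
  proof -
    have "set (drop k ws) \<subseteq> lists (gens n)" using sub set_drop_subset by fast
    then show ?thesis using is_tail_one_iff[OF rot_concat_lists]
      by (simp add: rot_prod_braid_of drop_map)
  qed
  show ?thesis
    unfolding is_splitting_def word_splitting_iff_drop tails rot_prod_braid_of[OF sub]
      length_map map_is_Nil_conv
    using carrier last assms by blast
qed

lemma splitting_braid_of: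
  assumes "word_splitting n ws"
  shows "splitting n (braid_of n (rot_concat n 0 ws)) = map (braid_of n) ws"
  unfolding splitting_def
proof (rule the_equality)
  show "is_splitting n (braid_of n (rot_concat n 0 ws)) (map (braid_of n) ws)"
    using is_splitting_iff[OF word_splitting_subset[OF assms]] assms by blast
next
  fix \<beta>s assume split: "is_splitting n (braid_of n (rot_concat n 0 ws)) \<beta>s"
  then have "set \<beta>s \<subseteq> braid_of n ` lists (gens (n - 1))"
    using carrier_dual_braid_monoid_mono(1)[of "n - 1" n] by (simp add: is_splitting_def)
  then have "\<beta>s \<in> lists (braid_of n ` lists (gens (n - 1)))" by blast
  then obtain vs where vs: "\<beta>s = map (braid_of n) vs" "vs \<in> lists (lists (gens (n - 1)))"
    unfolding lists_image by (elim imageE)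
  then have "set vs \<subseteq> lists (gens (n - 1))" by blast
  then have *: "word_splitting n vs" "braid_of n (rot_concat n 0 ws) = braid_of n (rot_concat n 0 vs)"
    using is_splitting_iff split vs(1) by blast+
  then have "dual_cong n (rot_concat n 0 ws) (rot_concat n 0 vs)"
    using braid_of_eq_iff[OF word_splitting_lists[OF assms]] by simp
  then have "list_all2 (dual_cong n) ws vs"
    by (rule word_splitting_unique[OF assms *(1)])
  then show "\<beta>s = map (braid_of n) ws"
    unfolding vs(1) by (induction rule: list_all2_induct) (simp_all add: braid_of_eqI)
qed

section \<open>The rotating normal form\<close>

lemma gens_2: "gens 2 = {(1, 2)}"
  by (auto simp: gens_def)

lemma lists_gens_2:
  assumes "w \<in> lists (gens 2)"
  shows "w = replicate (length w) (1, 2)"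
  using assms unfolding gens_2 by (induction w) auto

lemma rotating_nf_2:
  assumes "w \<in> lists (gens 2)"
  shows "rotating_nf 2 (braid_of 2 w) = w"
proof -
  have "v = w" if "v \<in> braid_of 2 w" for v
    using that dual_cong_lists[of 2 w v] dual_cong_length[of 2 w v] lists_gens_2[of v] lists_gens_2[of w]
    by (simp add: braid_of_def)
  moreover have "w \<in> braid_of 2 w" using dual_cong.refl[OF assms] by (simp add: braid_of_def)
  ultimately have "(THE v. v \<in> braid_of 2 w \<and> (\<exists>k. v = replicate k (1, 2))) = w"
    using lists_gens_2[OF assms] by (intro the_equality) auto
  then show ?thesis by (simp add: rotating_nf.simps)
qed

lemma rotating_nf_one: 
  assumes "n \<ge> 3"
  shows "rotating_nf n (braid_of n []) = []"
  using assms by (simp add: rotating_nf.simps one_braid_of)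

lemma rotating_nf_splitting:
  assumes "n \<ge> 3" "word_splitting n ws"
  shows "rotating_nf n (braid_of n (rot_concat n 0 ws))
    = rot_concat n 0 (map (\<lambda>v. rotating_nf (n - 1) (braid_of (n - 1) v)) ws)"
proof -
  have "braid_of n (rot_concat n 0 ws) \<noteq> braid_of n []"
    using braid_of_eq_one_iff word_splitting_lists word_splitting_nonempty assms(2) by blast
  moreover have "map (braid_of n) ws = map (braid_of (n - 1)) ws"
  proof (rule map_cong)
    fix v assume "v \<in> set ws"
    then have "v \<in> lists (gens (n - 1))" using word_splitting_subset[OF assms(2)] by blast
    then show "braid_of n v = braid_of (n - 1) v" by (rule braid_of_stable) simp
  qed simp
  ultimately show ?thesis
    using assms by (subst rotating_nf.simps) (simp add: one_braid_of splitting_braid_of cong: map_cong)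
qed

lemma rotating_nf_cong:
  assumes "n \<ge> 2" "w \<in> lists (gens n)"
  shows "dual_cong n w (rotating_nf n (braid_of n w))"
  using assms
proof (induction n arbitrary: w rule: less_induct)
  case (less n)
  consider "n = 2" | "n \<ge> 3" "w = []" | "n \<ge> 3" "w \<noteq> []" using less.prems(1) by linarith
  then show ?case
  proof cases
    case 1
    then show ?thesis using rotating_nf_2 dual_cong.refl less.prems(2) by simp
  next
    case 2
    then show ?thesis by (simp add: rotating_nf_one dual_cong.refl)
  next
    case 3
    obtain ws where ws: "word_splitting n ws" "dual_cong n w (rot_concat n 0 ws)"
      using word_splitting_exists[OF 3(1) less.prems(2) 3(2)] by blast
    let ?f = "\<lambda>v. rotating_nf (n - 1) (braid_of (n - 1) v)"
    have "dual_cong n v (?f v)" if "v \<in> set ws" for v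
    proof (rule dual_cong_mono)
      have "v \<in> lists (gens (n - 1))" using that word_splitting_subset[OF ws(1)] by blast
      then show "dual_cong (n - 1) v (?f v)" using 3(1) by (intro less.IH) simp_all
    qed simp
    then have "list_all2 (dual_cong n) ws (map ?f ws)"
      by (simp add: list_all2_map2 list.rel_refl_strong)
    then have "dual_cong n (rot_concat n 0 ws) (rot_concat n 0 (map ?f ws))"
      by (rule rot_concat_cong)
    then show ?thesis
      using ws(2) rotating_nf_splitting[OF 3(1) ws(1)] braid_of_eqI[OF ws(2)] dual_cong.trans by simp
  qed
qed

lemma rotating_words_lists:
  assumes "n \<ge> 2"
  shows "rotating_words n \<subseteq> lists (gens n)"
  unfolding rotating_words_def carrier_braid_of
  using rotating_nf_cong[OF assms] dual_cong_lists by blast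

lemma rotating_nf_fixes_rotating_words:
  assumes "n \<ge> 2" "w \<in> rotating_words n"
  shows "rotating_nf n (braid_of n w) = w"
proof -
  obtain v where "v \<in> lists (gens n)" "w = rotating_nf n (braid_of n v)"
    using assms(2) unfolding rotating_words_def carrier_braid_of by blast
  then show ?thesis using braid_of_eqI[OF rotating_nf_cong[OF assms(1)]] by simp
qed

text \<open>
  The factors may be taken to be normal forms, since replacing them by congruent words
  preserves splittings. In the other direction, uniqueness of the splitting shows that the normal form of
  such a concatenation is the concatenation itself.
\<close>

lemma rotating_words_eq:
  assumes "n \<ge> 3"
  shows "rotating_words n =
    insert [] {rot_concat n 0 ws |ws. word_splitting n ws \<and> set ws \<subseteq> rotating_words (n - 1)}"
proof (intro equalityI subsetI)
  fix x assume "x \<in> rotating_words n"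
  then obtain w where w: "w \<in> lists (gens n)" "x = rotating_nf n (braid_of n w)"
    unfolding rotating_words_def carrier_braid_of by blast
  show "x \<in> insert [] {rot_concat n 0 ws |ws. word_splitting n ws \<and> set ws \<subseteq> rotating_words (n - 1)}"
  proof (cases "w = []")
    case True
    then show ?thesis using w rotating_nf_one[OF assms] by simp
  next
    case False
    obtain ws where ws: "word_splitting n ws" "dual_cong n w (rot_concat n 0 ws)"
      using word_splitting_exists[OF assms w(1) False] by blast
    let ?f = "\<lambda>v. rotating_nf (n - 1) (braid_of (n - 1) v)"
    have l: "v \<in> lists (gens (n - 1))" if "v \<in> set ws" for v
      using that word_splitting_subset[OF ws(1)] by blast
    have "dual_cong (n - 1) v (?f v)" if "v \<in> set ws" for v
      using l[OF that] assms by (intro rotating_nf_cong) simp_all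
    then have "list_all2 (dual_cong (n - 1)) ws (map ?f ws)"
      by (simp add: list_all2_map2 list.rel_refl_strong)
    then have "word_splitting n (map ?f ws)" using word_splitting_cong ws(1) by blast
    moreover have "set (map ?f ws) \<subseteq> rotating_words (n - 1)"
      unfolding rotating_words_def carrier_braid_of using l by auto
    moreover have "x = rot_concat n 0 (map ?f ws)"
      using w(2) rotating_nf_splitting[OF assms ws(1)] braid_of_eqI[OF ws(2)] by simp
    ultimately show ?thesis by blast
  qed
next
  fix x assume "x \<in> insert [] {rot_concat n 0 ws |ws. word_splitting n ws \<and> set ws \<subseteq> rotating_words (n - 1)}"
  then consider "x = []" | ws where "x = rot_concat n 0 ws" "word_splitting n ws"
    "set ws \<subseteq> rotating_words (n - 1)" by blast
  then show "x \<in> rotating_words n"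
  proof cases
    case 1
    then show ?thesis using rotating_nf_one[OF assms]
      unfolding rotating_words_def carrier_braid_of by (intro image_eqI[of _ _ "braid_of n []"]) auto
  next
    case 2
    have "map (\<lambda>v. rotating_nf (n - 1) (braid_of (n - 1) v)) ws = ws"
      using 2(3) rotating_nf_fixes_rotating_words[of "n - 1"] assms by (intro map_idI) auto
    then have "x = rotating_nf n (braid_of n x)"
      using rotating_nf_splitting[OF assms 2(2)] 2(1) by simp
    then show ?thesis using word_splitting_lists[OF 2(2), of 0] 2(1)
      unfolding rotating_words_def carrier_braid_of by blast
  qed
qed

section \<open>Regular languages and finite invariants of words\<close>

text \<open>
  A function on words with finitely many values that is compatible with appending a letter is an
  automaton in disguise: its values, numbered by natural numbers, are the states.
\<close>

lemma regular_languageI: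
  fixes f :: "'a list \<Rightarrow> 'b"
  assumes "L \<subseteq> lists \<Sigma>" "finite (f ` lists \<Sigma>)"
    and step: "\<And>u v a. u \<in> lists \<Sigma> \<Longrightarrow> v \<in> lists \<Sigma> \<Longrightarrow> a \<in> \<Sigma> \<Longrightarrow> f u = f v \<Longrightarrow> f (u @ [a]) = f (v @ [a])"
    and mem: "\<And>u v. u \<in> lists \<Sigma> \<Longrightarrow> v \<in> lists \<Sigma> \<Longrightarrow> f u = f v \<Longrightarrow> u \<in> L \<Longrightarrow> v \<in> L"
  shows "regular_language \<Sigma> L"
proof -
  obtain g :: "'b \<Rightarrow> nat" where g: "inj_on g (f ` lists \<Sigma>)"
    using finite_imp_inj_to_nat_seg[OF assms(2)] by blast
  define h where "h = g \<circ> f"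
  have h: "h u = h v \<longleftrightarrow> f u = f v" if "u \<in> lists \<Sigma>" "v \<in> lists \<Sigma>" for u v
    using g that by (auto simp: h_def inj_on_def)
  define rep where "rep s = (SOME u. u \<in> lists \<Sigma> \<and> h u = s)" for s
  define \<delta> where "\<delta> s a = h (rep s @ [a])" for s a
  have rep: "rep (h u) \<in> lists \<Sigma> \<and> h (rep (h u)) = h u" if "u \<in> lists \<Sigma>" for u
    unfolding rep_def by (rule someI[of _ u]) (use that in simp)
  have \<delta>: "\<delta> (h u) a = h (u @ [a])" if "u \<in> lists \<Sigma>" "a \<in> \<Sigma>" for u a
  proof -
    have "f (rep (h u) @ [a]) = f (u @ [a])"
      using rep[OF that(1)] that h by (intro step) auto
    then show ?thesis by (simp add: \<delta>_def h_def)
  qed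
  have run: "foldl \<delta> (h []) w = h w" if "w \<in> lists \<Sigma>" for w
    using that by (induction w rule: rev_induct) (simp_all add: \<delta> del: in_lists_conv_set)
  have "finite (h ` lists \<Sigma>)" using finite_imageI[OF assms(2), of g] by (simp add: h_def image_image)
  moreover have "\<forall>q\<in>h ` lists \<Sigma>. \<forall>a\<in>\<Sigma>. \<delta> q a \<in> h ` lists \<Sigma>"
  proof (intro ballI)
    fix q a assume "q \<in> h ` lists \<Sigma>" "a \<in> \<Sigma>"
    then obtain u where "u \<in> lists \<Sigma>" "q = h u" by blast
    then show "\<delta> q a \<in> h ` lists \<Sigma>" using \<delta> \<open>a \<in> \<Sigma>\<close> by (intro image_eqI[of _ _ "u @ [a]"]) auto
  qed
  moreover have "L = {w \<in> lists \<Sigma>. foldl \<delta> (h []) w \<in> h ` L}"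
  proof (intro equalityI subsetI)
    fix w assume "w \<in> {w \<in> lists \<Sigma>. foldl \<delta> (h []) w \<in> h ` L}"
    then have w: "w \<in> lists \<Sigma>" and "foldl \<delta> (h []) w \<in> h ` L" by blast+
    then obtain v where v: "v \<in> L" "h v = h w" unfolding run[OF w] by auto
    then show "w \<in> L" using mem[of v w] h w assms(1) by blast
  next
    fix w assume "w \<in> L"
    then show "w \<in> {w \<in> lists \<Sigma>. foldl \<delta> (h []) w \<in> h ` L}"
      using assms(1) run[of w] by blast
  qed
  ultimately show ?thesis
    unfolding regular_language_def using assms(1)
    by (intro exI[of _ "h ` lists \<Sigma>"] exI[of _ "h []"] exI[of _ "h ` L"] exI[of _ \<delta>]) auto
qed

lemma regular_languageE:
  assumes "regular_language \<Sigma> L"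
  obtains f :: "'a list \<Rightarrow> nat" where "finite (f ` lists \<Sigma>)"
    "\<And>u v a. f u = f v \<Longrightarrow> f (u @ [a]) = f (v @ [a])"
    "\<And>u v. u \<in> lists \<Sigma> \<Longrightarrow> v \<in> lists \<Sigma> \<Longrightarrow> f u = f v \<Longrightarrow> u \<in> L \<Longrightarrow> v \<in> L"
proof -
  obtain Q :: "nat set" and q F \<delta> where A: "finite Q" "q \<in> Q" "\<forall>q\<in>Q. \<forall>a\<in>\<Sigma>. \<delta> q a \<in> Q"
      "L = {w \<in> lists \<Sigma>. foldl \<delta> q w \<in> F}"
    using assms unfolding regular_language_def by blast
  have "foldl \<delta> q w \<in> Q" if "w \<in> lists \<Sigma>" for w
    using that by (induction w rule: rev_induct) (use A in auto)
  then have "finite (foldl \<delta> q ` lists \<Sigma>)" using A(1) by (meson finite_subset image_subsetI)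
  then show ?thesis using A(4) by (intro that[of "foldl \<delta> q"]) auto
qed

section \<open>Reading a rotating word from left to right\<close>

lemma right_div_rot_pow:
  assumes "right_div n [a] w"
  shows "right_div n [(rot n ^^ m) a] (map (rot n ^^ m) w)"
proof -
  obtain X where "dual_cong n w (X @ [a])" using assms unfolding right_div_def by blast
  from dual_cong_rot_pow[OF this, of m] show ?thesis unfolding right_div_def by auto
qed

lemma right_div_rot_pow_cancel:
  assumes "right_div n [(rot n ^^ m) a] (map (rot n ^^ m) w)" "a \<in> gens n" "w \<in> lists (gens n)"
  shows "right_div n [a] w"
  using assms(1)
proof (induction m)
  case (Suc m)
  have "right_div n (map (rot n) [(rot n ^^ m) a]) (map (rot n) (map (rot n ^^ m) w))"
    using Suc.prems by (simp add: comp_def)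
  then have "right_div n [(rot n ^^ m) a] (map (rot n ^^ m) w)"
    by (rule right_div_rot_cancel)
      (use rot_pow_gens[OF assms(2)] map_rot_pow_lists[OF assms(3)] in simp_all)
  then show ?case by (rule Suc.IH)
qed simp

lemma rot_concat_add: "rot_concat n (m + k) ws = map (rot n ^^ m) (rot_concat n k ws)"
  by (induction m) (simp_all add: rot_concat_Suc comp_def)

lemma rot_concat_mod:
  assumes "set ws \<subseteq> lists (gens n)"
  shows "rot_concat n m ws = rot_concat n (m mod n) ws"
  using rot_concat_add[of n m 0 ws] rot_concat_add[of n "m mod n" 0 ws]
    map_rot_pow_mod[OF rot_concat_lists[OF assms], of m 0] by simp

text \<open>
  \<open>reading n R u m v\<close> means that \<open>u\<close> can be cut into blocks such that the current block was read under the
  rotation \<open>\<phi>\<^sup>m\<close> and is so far the image of \<open>v\<close>, that the earlier blocks are images of words of \<open>R\<close>, and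
  that the condition on tails holds at each boundary passed. The first block starts with an arbitrary
  rotation, because the number of blocks is not known in advance; each later one has a rotation less by
  one, modulo \<open>n\<close>. The condition \<open>u \<noteq> []\<close> at a boundary says that the leftmost factor is
  nontrivial, and later blocks may be empty.
\<close>

inductive reading :: "nat \<Rightarrow> word set \<Rightarrow> word \<Rightarrow> nat \<Rightarrow> word \<Rightarrow> bool"
  for n :: nat and R :: "word set" where
  start: "m < n \<Longrightarrow> reading n R [] m []"
| letter: "reading n R u m v \<Longrightarrow> a \<in> gens (n - 1) \<Longrightarrow>
    reading n R (u @ [(rot n ^^ m) a]) m (v @ [a])"
| next_block: "reading n R u (Suc m mod n) v \<Longrightarrow> m < n \<Longrightarrow> v \<in> R \<Longrightarrow> u \<noteq> [] \<Longrightarrow>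
    (\<And>a. a \<in> gens (n - 1) \<Longrightarrow> \<not> right_div n [(rot n ^^ m) a] u) \<Longrightarrow> reading n R u m []"

lemma reading_bounds: "reading n R u m v \<Longrightarrow> m < n \<and> v \<in> lists (gens (n - 1))"
  by (induction rule: reading.induct) auto

lemma reading_letters:
  assumes "reading n R u m []" "w \<in> lists (gens (n - 1))"
  shows "reading n R (u @ map (rot n ^^ m) w) m w"
  using assms(2)
proof (induction w rule: rev_induct)
  case (snoc a w)
  then have "reading n R ((u @ map (rot n ^^ m) w) @ [(rot n ^^ m) a]) m (w @ [a])"
    by (intro reading.letter) simp_all
  then show ?case by simp
qed (use assms(1) in simp)

text \<open>
  The blocks read so far form a splitting. Rotations are known only modulo \<open>n\<close>, which suffices by
  periodicity.
\<close>

lemma reading_splitting: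
  assumes "reading n R u m v" "R \<subseteq> lists (gens (n - 1))"
  shows "\<exists>ws. set ws \<subseteq> R \<and> u = rot_concat n m (v # ws) \<and> (ws = [] \<or> word_splitting n (v # ws))"
  using assms(1)
proof (induction rule: reading.induct)
  case (start m)
  show ?case by (intro exI[of _ "[]"]) simp
next
  case (letter u m v a)
  then obtain ws where "set ws \<subseteq> R" "u = rot_concat n m (v # ws)" "ws = [] \<or> word_splitting n (v # ws)"
    by blast
  then show ?case using letter.hyps(2) by (intro exI[of _ ws]) auto
next
  case (next_block u m v)
  then obtain ws where ws: "set ws \<subseteq> R" "u = rot_concat n (Suc m mod n) (v # ws)"
      "ws = [] \<or> word_splitting n (v # ws)" by blast
  have v: "v \<in> lists (gens (n - 1))" using next_block.hyps(3) assms(2) by blast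
  have R: "set (v # ws) \<subseteq> R" using ws(1) next_block.hyps(3) by simp
  from this have "set (v # ws) \<subseteq> lists (gens (n - 1))" using assms(2) by (rule order.trans)
  moreover have "lists (gens (n - 1)) \<subseteq> lists (gens n)" by (intro lists_mono gens_mono) simp
  ultimately have sub: "set (v # ws) \<subseteq> lists (gens n)" by (rule order.trans)
  have u: "u = rot_concat n (Suc m) (v # ws)" using rot_concat_mod[OF sub] ws(2) by metis
  then have u1: "u = map (rot n ^^ m) (rot_concat n 1 (v # ws))"
    using rot_concat_add[of n m 1 "v # ws"] by simp
  have split: "word_splitting n (v # ws)"
  proof (cases "ws = []")
    case True
    then show ?thesis using u next_block.hyps(4) v by auto
  qed (use ws(3) in blast)
  have "no_tail n (rot_concat n 1 (v # ws))"
    unfolding no_tail_def using right_div_rot_pow next_block.hyps(5) u1 by blast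
  then have "word_splitting n ([] # v # ws)"
    using split by (simp only: word_splitting.simps(2)[of n "[]"] lists.Nil list.distinct if_False simp_thms)
  moreover have "u = rot_concat n m ([] # v # ws)" using u by simp
  ultimately show ?case using R by blast
qed

lemma splitting_reading:
  assumes "word_splitting n ws" "set ws \<subseteq> R" "m < n"
  shows "reading n R (rot_concat n m ws) m (hd ws)"
  using assms
proof (induction ws arbitrary: m)
  case (Cons w ws)
  have w: "w \<in> lists (gens (n - 1))" using Cons.prems(1) by simp
  have "reading n R (rot_concat n (Suc m) ws) m []"
  proof (cases "ws = []")
    case True
    then show ?thesis using reading.start[OF Cons.prems(3)] by simp
  next
    case False
    then have split: "word_splitting n ws" and nt: "no_tail n (rot_concat n 1 ws)"
      using Cons.prems(1) by simp_all
    have l: "rot_concat n 1 ws \<in> lists (gens n)" using split by (rule word_splitting_lists)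
    have u: "rot_concat n (Suc m) ws = map (rot n ^^ m) (rot_concat n 1 ws)"
      using rot_concat_add[of n m 1 ws] by simp
    have "set ws \<subseteq> lists (gens n)"
      using word_splitting_subset[OF split] lists_mono[OF gens_mono[of "n - 1" n]] by auto
    then have "rot_concat n (Suc m mod n) ws = rot_concat n (Suc m) ws"
      using rot_concat_mod by metis
    moreover have "reading n R (rot_concat n (Suc m mod n) ws) (Suc m mod n) (hd ws)"
      using split Cons.prems(2,3) by (intro Cons.IH) simp_all
    ultimately have "reading n R (rot_concat n (Suc m) ws) (Suc m mod n) (hd ws)" by simp
    then show ?thesis
    proof (rule reading.next_block)
      show "hd ws \<in> R" using False Cons.prems(2) by (cases ws) auto
      show "rot_concat n (Suc m) ws \<noteq> []" using split by (rule word_splitting_nonempty)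
      fix a assume a: "a \<in> gens (n - 1)"
      then have an: "a \<in> gens n" using gens_mono[of "n - 1" n] by auto
      show "\<not> right_div n [(rot n ^^ m) a] (rot_concat n (Suc m) ws)"
        using right_div_rot_pow_cancel[OF _ an l] nt a unfolding u no_tail_def by blast
    qed (rule Cons.prems(3))
  qed
  then show ?case using reading_letters[OF _ w] by simp
qed simp

lemma Nil_in_rotating_words:
  assumes "n \<ge> 2"
  shows "[] \<in> rotating_words n"
proof (cases "n = 2")
  case True
  then show ?thesis unfolding rotating_words_def carrier_braid_of
    using rotating_nf_2[of "[]"] by (intro image_eqI[of _ _ "braid_of 2 []"]) auto
next
  case False
  then show ?thesis using rotating_words_eq[of n] assms by simp
qed

text \<open>
  The last block is the one without rotation, hence the index \<open>0\<close>.
\<close>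

lemma rotating_words_reading:
  assumes "n \<ge> 3"
  shows "rotating_words n = {u. \<exists>v\<in>rotating_words (n - 1). reading n (rotating_words (n - 1)) u 0 v}"
    (is "_ = {u. \<exists>v\<in>?R. reading n ?R u 0 v}")
proof (intro equalityI subsetI)
  fix u assume "u \<in> rotating_words n"
  then consider "u = []" | ws where "u = rot_concat n 0 ws" "word_splitting n ws" "set ws \<subseteq> ?R"
    unfolding rotating_words_eq[OF assms] by blast
  then show "u \<in> {u. \<exists>v\<in>?R. reading n ?R u 0 v}"
  proof cases
    case 1
    then show ?thesis
      using reading.start[of 0 n ?R] Nil_in_rotating_words[of "n - 1"] assms by auto
  next
    case 2
    moreover from this have "hd ws \<in> ?R" by (cases ws) auto
    ultimately show ?thesis using splitting_reading[OF 2(2,3), of 0] assms by auto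
  qed
next
  fix u assume "u \<in> {u. \<exists>v\<in>?R. reading n ?R u 0 v}"
  then obtain v where v: "v \<in> ?R" "reading n ?R u 0 v" by blast
  have R: "?R \<subseteq> lists (gens (n - 1))" using assms by (intro rotating_words_lists) simp
  obtain ws where ws: "set ws \<subseteq> ?R" "u = rot_concat n 0 (v # ws)"
      "ws = [] \<or> word_splitting n (v # ws)"
    using reading_splitting[OF v(2) R] by blast
  show "u \<in> rotating_words n"
  proof (cases "u = []")
    case True
    then show ?thesis using Nil_in_rotating_words assms by simp
  next
    case False
    then have "word_splitting n (v # ws)" using ws(2,3) v(1) R by auto
    moreover have "set (v # ws) \<subseteq> ?R" using ws(1) v(1) by simp
    ultimately show ?thesis unfolding rotating_words_eq[OF assms] using ws(2) by blast
  qed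
qed

section \<open>Regularity\<close>

text \<open>
  The possible states after \<open>u x\<close> are determined by those after \<open>u\<close>: the letter \<open>x\<close> is read
  once, and all further steps are block boundaries, which depend only on the simple right divisors of the word
  read so far and on whether the block just finished belongs to \<open>R\<close>.
\<close>

lemma reading_transfer:
  assumes "reading n R w m v" "w = u @ [x]"
    and f_step: "\<And>u v a. f u = f v \<Longrightarrow> f (u @ [a]) = f (v @ [a])"
    and f_mem: "\<And>u v. u \<in> lists (gens (n - 1)) \<Longrightarrow> v \<in> lists (gens (n - 1)) \<Longrightarrow>
        f u = f v \<Longrightarrow> u \<in> R \<Longrightarrow> v \<in> R"
    and states: "\<And>m v. reading n R u m v \<Longrightarrow> \<exists>v'. reading n R u' m v' \<and> f v' = f v"
    and tails: "simple_tails n (u @ [x]) = simple_tails n (u' @ [x])"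
  shows "\<exists>v'. reading n R (u' @ [x]) m v' \<and> f v' = f v"
  using assms(1,2)
proof (induction rule: reading.induct)
  case (letter u0 m v a)
  then have u0: "u0 = u" "x = (rot n ^^ m) a" by auto
  obtain v' where v': "reading n R u' m v'" "f v' = f v" using states letter.hyps(1) u0(1) by blast
  then have "reading n R (u' @ [x]) m (v' @ [a])"
    unfolding u0(2) using letter.hyps(2) by (intro reading.letter)
  then show ?case using f_step[OF v'(2)] by blast
next
  case (next_block u0 m v)
  obtain v' where v': "reading n R (u' @ [x]) (Suc m mod n) v'" "f v' = f v"
    using next_block.IH next_block.prems by blast
  have "v \<in> lists (gens (n - 1))" "v' \<in> lists (gens (n - 1))"
    using reading_bounds[OF next_block.hyps(1)] reading_bounds[OF v'(1)] by blast+
  then have "v' \<in> R" using v'(2)[symmetric] next_block.hyps(3) by (rule f_mem)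
  moreover have "\<not> right_div n [(rot n ^^ m) a] (u' @ [x])" if "a \<in> gens (n - 1)" for a
    using next_block.hyps(5)[OF that] next_block.prems tails
    by (simp flip: letter_in_simple_tails)
  ultimately have "reading n R (u' @ [x]) m []"
    using v'(1) next_block.hyps(2) by (intro reading.next_block) auto
  then show ?case by blast
qed simp

lemma regular_rotating_words_step:
  assumes "n \<ge> 3" "regular_language (gens (n - 1)) (rotating_words (n - 1))"
  shows "regular_language (gens n) (rotating_words n)"
proof -
  let ?R = "rotating_words (n - 1)"
  obtain f :: "word \<Rightarrow> nat" where fin: "finite (f ` lists (gens (n - 1)))"
    and f_step: "\<And>u v a. f u = f v \<Longrightarrow> f (u @ [a]) = f (v @ [a])"
    and f_mem: "\<And>u v. u \<in> lists (gens (n - 1)) \<Longrightarrow> v \<in> lists (gens (n - 1)) \<Longrightarrow>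
        f u = f v \<Longrightarrow> u \<in> ?R \<Longrightarrow> v \<in> ?R"
    using assms(2) by (rule regular_languageE) (rule that)
  define S where "S u = {(m, f v) | m v. reading n ?R u m v}" for u
  define state where "state u = (S u, simple_tails n u)" for u
  have transfer: "\<exists>v'. reading n ?R u' m v' \<and> f v' = f v"
    if "S u = S u'" "reading n ?R u m v" for u u' m v
  proof -
    have "(m, f v) \<in> S u" unfolding S_def using that(2) by blast
    then have "(m, f v) \<in> S u'" using that(1) by simp
    then show ?thesis unfolding S_def by auto
  qed
  show ?thesis
  proof (rule regular_languageI)
    show "rotating_words n \<subseteq> lists (gens n)" using assms(1) by (intro rotating_words_lists) simp
    have "S u \<in> Pow ({..<n} \<times> f ` lists (gens (n - 1)))" for u
      unfolding S_def using reading_bounds by blast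
    then have "state ` lists (gens n) \<subseteq>
        Pow ({..<n} \<times> f ` lists (gens (n - 1))) \<times> range (simple_tails n)"
      unfolding state_def by blast
    moreover have "finite (Pow ({..<n} \<times> f ` lists (gens (n - 1))) \<times> range (simple_tails n))"
      using fin finite_range_simple_tails by blast
    ultimately show "finite (state ` lists (gens n))" by (rule finite_subset)
  next
    fix u v x assume uv: "u \<in> lists (gens n)" "v \<in> lists (gens n)" "x \<in> gens n" "state u = state v"
    then have eq: "S u = S v" "simple_tails n u = simple_tails n v" by (simp_all add: state_def)
    have tails: "simple_tails n (u @ [x]) = simple_tails n (v @ [x])"
      using simple_tails_snoc[OF uv(1,3)] simple_tails_snoc[OF uv(2,3)] eq(2) by simp
    have sub: "S (y @ [x]) \<subseteq> S (z @ [x])"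
      if eq: "S y = S z" "simple_tails n (y @ [x]) = simple_tails n (z @ [x])" for y z
    proof
      fix s assume "s \<in> S (y @ [x])"
      then obtain m v where s: "s = (m, f v)" "reading n ?R (y @ [x]) m v" unfolding S_def by blast
      have "\<exists>v'. reading n ?R (z @ [x]) m v' \<and> f v' = f v"
        by (rule reading_transfer[where f = f, OF s(2) HOL.refl f_step f_mem transfer[OF eq(1)] eq(2)])
      then obtain v' where v': "reading n ?R (z @ [x]) m v'" "f v' = f v" by blast
      have "s = (m, f v')" using s(1) v'(2) by simp
      then show "s \<in> S (z @ [x])" unfolding S_def using v'(1) by blast
    qed
    show "state (u @ [x]) = state (v @ [x])"
      unfolding state_def using sub[OF eq(1) tails] sub[OF eq(1)[symmetric] tails[symmetric]] tails
      by blast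
  next
    fix u v assume "state u = state v" "u \<in> rotating_words n"
    then obtain w where w: "w \<in> ?R" "reading n ?R u 0 w" and "S u = S v"
      unfolding rotating_words_reading[OF assms(1)] state_def by blast
    then obtain w' where w': "reading n ?R v 0 w'" "f w' = f w" using transfer by blast
    then have "w' \<in> ?R"
      using f_mem[of w w'] reading_bounds[OF w(2)] reading_bounds[OF w'(1)] w(1) by simp
    then show "v \<in> rotating_words n"
      using w'(1) unfolding rotating_words_reading[OF assms(1)] by blast
  qed
qed

lemma regular_rotating_words_2: "regular_language (gens 2) (rotating_words 2)"
proof (rule regular_languageI[where f = "\<lambda>_. ()"])
  show "rotating_words 2 \<subseteq> lists (gens 2)" by (rule rotating_words_lists) simp
  fix v assume "v \<in> lists (gens 2)"
  then show "v \<in> rotating_words 2"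
    unfolding rotating_words_def carrier_braid_of using rotating_nf_2[of v] 
    by (intro image_eqI[of _ _ "braid_of 2 v"]) auto
qed simp_all

theorem theorem5p9:
  fixes n :: nat
  assumes "n \<ge> 2"
  shows "regular_language (gens n) (rotating_words n)"
  using assms
proof (induction n rule: dec_induct)
  case base
  show ?case by (rule regular_rotating_words_2)
next
  case (step n)
  then show ?case using regular_rotating_words_step[of "Suc n"] by simp
qed

end
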